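(* Let $r,u\ge 2$ be integers, $k=r(u-1)$, $q=(r-1)(u-1)$. Let $H$ be an $r$-regular $u$-uniform hypergraph with $n$ vertices and second eigenvalue $\tau_2$. Let $(d,c)$ be the unique pair consisting of an integer $d\ge 1$ and a real number $c\ge 1$ such that $$n=1+\sum_{j=0}^{d-2}kq^j+\frac{kq^{d-1}}{c}.$$ Let $\lambda(d,c)$ be the largest zero of $\sum_{i=0}^{d-1}cF_i^{(r,u)}(x)+F_d^{(r,u)}(x)$. Then $\tau_2\ge\lambda(d,c)$. Moreover, $\tau_2=\lambda(d,c)$ if and only if $H$ is a generalized Moore geometry of diameter $d$ whose intersection array is $$\begin{pmatrix} * & 1&\cdots&1&c\\ 0&u-2&\cdots&u-2&k-c\\ k&q&\cdots&q&*\end{pmatrix}.$$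
   Context: A hypergraph $H=(V,E)$ consists of a finite vertex set $V$ and a set $E$ of subsets of $V$ (edges), each of size at least 2 (no repeated edges). It is $u$-uniform if every edge has exactly $u$ vertices and $r$-regular if every vertex is in exactly $r$ edges. The adjacency matrix has entries $A_{xy}=|\{e\in E:\{x,y\}\subset e\}|$ for $x\neq y$ and $A_{xx}=0$; the eigenvalues of $H$ are those of $A$, and the second eigenvalue is the second largest one (with multiplicity). The point (multi)graph $\Gamma_H$ is the multigraph on $V$ with $A_{xy}$ edges between $x$ and $y$. Polynomials: $F_0^{(r,u)}=1$, $F_1^{(r,u)}=x$, $F_2^{(r,u)}=x^2-(u-2)x-r(u-1)$, $F_{i+1}^{(r,u)}(x)=(x-u+2)F_i^{(r,u)}(x)-(r-1)(u-1)F_{i-1}^{(r,u)}(x)$ for $i\ge 2$. An $r$-regular $u$-uniform hypergraph $H$ is a generalized Moore geometry of diameter $d$ if $\Gamma_H$ is connected of diameter $d$, any two distinct vertices at distance less than $d$ are joined by a unique shortest path, and any two vertices at distance $d$ are joined by exactly $c$ distinct shortest paths, for a constant $c$ (paths counted in the multigraph). Its intersection array is the displayed one if for all vertices $x,y$ at distance $i$ in $\Gamma_H$, the number of edges of $\Gamma_H$ (counted with multiplicity) joining $y$ to vertices at distance $i-1$, $i$, $i+1$ from $x$ is, respectively, $c_i$, $a_i$, $b_i$, where the columns ($i=0,\dots,d$) are $(c_i,a_i,b_i)^T$: $c_i=1$ for $1\le i\le d-1$, $c_d=c$; $a_0=0$, $a_i=u-2$ for $1\le i\le d-1$, $a_d=k-c$;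 $b_0=k$, $b_i=q$ for $1\le i\le d-1$. (When $\Gamma_H$ is simple this says that $\Gamma_H$ is distance-regular with this intersection array.) *)

theory Defs
  imports
    "HOL-Library.Countable_Set"
    "HOL-Computational_Algebra.Polynomial"
    "Jordan_Normal_Form.Char_Poly"
    "Graph_Theory.Shortest_Path"
    "Graph_Theory.Digraph_Component"
begin

definition hypergraph :: "'v set \<Rightarrow> 'v set set \<Rightarrow> bool" where
  "hypergraph V E \<longleftrightarrow> finite V \<and> (\<forall>e\<in>E. e \<subseteq> V \<and> card e \<ge> 2)"

definition uniform :: "'v set set \<Rightarrow> nat \<Rightarrow> bool" where
  "uniform E u \<longleftrightarrow> (\<forall>e\<in>E. card e = u)"

definition regular :: "'v set \<Rightarrow> 'v set set \<Rightarrow> nat \<Rightarrow> bool" where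
  "regular V E r \<longleftrightarrow> (\<forall>x\<in>V. card {e \<in> E. x \<in> e} = r)"

definition adjacency :: "'v set set \<Rightarrow> 'v \<Rightarrow> 'v \<Rightarrow> nat" where
  "adjacency E x y = (if x = y then 0 else card {e \<in> E. {x, y} \<subseteq> e})"

text \<open>The vertices are numbered \<open>0, \<dots>, card V - 1\<close> by \<^const>\<open>from_nat_into\<close>, which restricts
  to a bijection from \<open>{..<card V}\<close> onto a finite \<open>V\<close>. Another numbering conjugates the matrix
  by a permutation, so the characteristic polynomial does not depend on it.\<close>

definition adjacency_matrix :: "'v set \<Rightarrow> 'v set set \<Rightarrow> real mat" where
  "adjacency_matrix V E = mat (card V) (card V)
     (\<lambda>(i, j). real (adjacency E (from_nat_into V i) (from_nat_into V j)))"

text \<open>The list contains every eigenvalue as often as its algebraic multiplicity, in ascending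
  order; its reversal starts with the largest eigenvalue at index 0.\<close>

definition second_eigenvalue :: "'v set \<Rightarrow> 'v set set \<Rightarrow> real" where
  "second_eigenvalue V E =
     rev (sorted_list_of_multiset (proots (char_poly (adjacency_matrix V E)))) ! 1"

text \<open>The point multigraph: the undirected edges joining \<open>x\<close> and \<open>y\<close> are the hyperedges
  containing both. As usual in \<^theory>\<open>Graph_Theory.Digraph\<close>, each of them is
  represented by two opposite arcs, so the arcs with tail \<open>y\<close> are in bijection with the
  undirected edges at \<open>y\<close>, and the paths from \<open>x\<close> to \<open>y\<close> (lists of arcs) with the
  undirected paths, parallel edges being distinguished.\<close>

definition point_multigraph :: "'v set \<Rightarrow> 'v set set \<Rightarrow> ('v, 'v \<times> 'v set \<times> 'v) pre_digraph" where
  "point_multigraph V E =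
     \<lparr> verts = V,
       arcs = {(x, e, y) | x e y. e \<in> E \<and> x \<in> e \<and> y \<in> e \<and> x \<noteq> y},
       tail = (\<lambda>(x, e, y). x),
       head = (\<lambda>(x, e, y). y) \<rparr>"

definition graph_distance :: "('v, 'a) pre_digraph \<Rightarrow> 'v \<Rightarrow> 'v \<Rightarrow> ereal" where
  "graph_distance G x y = wf_digraph.\<mu> G (\<lambda>_. 1) x y"

definition graph_diameter :: "('v, 'a) pre_digraph \<Rightarrow> ereal" where
  "graph_diameter G = (SUP (x, y) \<in> verts G \<times> verts G. graph_distance G x y)"

definition shortest_paths :: "('v, 'a) pre_digraph \<Rightarrow> 'v \<Rightarrow> 'v \<Rightarrow> 'a list set" where
  "shortest_paths G x y =
     {p. pre_digraph.apath G x p y \<and> ereal (real (length p)) = graph_distance G x y}"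

definition generalized_Moore_geometry ::
    "'v set \<Rightarrow> 'v set set \<Rightarrow> nat \<Rightarrow> nat \<Rightarrow> nat \<Rightarrow> bool" where
  "generalized_Moore_geometry V E r u d \<longleftrightarrow>
     (let G = point_multigraph V E in
        hypergraph V E \<and> regular V E r \<and> uniform E u \<and>
        Digraph_Component.connected G \<and> graph_diameter G = ereal (real d) \<and>
        (\<forall>x\<in>V. \<forall>y\<in>V. x \<noteq> y \<and> graph_distance G x y < ereal (real d) \<longrightarrow>
           card (shortest_paths G x y) = 1) \<and>
        (\<exists>m::nat. \<forall>x\<in>V. \<forall>y\<in>V. graph_distance G x y = ereal (real d) \<longrightarrow>
           card (shortest_paths G x y) = m))"

definition num_edges_to_distance ::
    "('v, 'a) pre_digraph \<Rightarrow> 'v \<Rightarrow> 'v \<Rightarrow> nat \<Rightarrow> nat" where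
  "num_edges_to_distance G x y j =
     card {a \<in> arcs G. tail G a = y \<and> graph_distance G x (head G a) = ereal (real j)}"

text \<open>The entries \<open>cs 0\<close> and \<open>bs d\<close> are the stars of the array and are not constrained.\<close>

definition has_intersection_array ::
    "('v, 'a) pre_digraph \<Rightarrow> nat \<Rightarrow> (nat \<Rightarrow> real) \<Rightarrow> (nat \<Rightarrow> real) \<Rightarrow> (nat \<Rightarrow> real) \<Rightarrow> bool" where
  "has_intersection_array G d cs as bs \<longleftrightarrow>
     (\<forall>x\<in>verts G. \<forall>y\<in>verts G. \<forall>i\<le>d. graph_distance G x y = ereal (real i) \<longrightarrow>
        (1 \<le> i \<longrightarrow> real (num_edges_to_distance G x y (i - 1)) = cs i) \<and>
        real (num_edges_to_distance G x y i) = as i \<and>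
        (i < d \<longrightarrow> real (num_edges_to_distance G x y (i + 1)) = bs i))"

fun F_poly :: "nat \<Rightarrow> nat \<Rightarrow> nat \<Rightarrow> real poly" where
  "F_poly r u 0 = 1"
| "F_poly r u (Suc 0) = [:0, 1:]"
| "F_poly r u (Suc (Suc 0)) = [:- (real r * (real u - 1)), - (real u - 2), 1:]"
| "F_poly r u (Suc (Suc (Suc i))) =
     [:- (real u - 2), 1:] * F_poly r u (Suc (Suc i))
     - Polynomial.smult ((real r - 1) * (real u - 1)) (F_poly r u (Suc i))"

definition lambda_dc :: "nat \<Rightarrow> nat \<Rightarrow> nat \<Rightarrow> real \<Rightarrow> real" where
  "lambda_dc r u d c = Max {x. poly ((\<Sum>i<d. Polynomial.smult c (F_poly r u i)) + F_poly r u d) x = 0}"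

text \<open>For \<open>d = 1\<close> the sum is empty.\<close>

definition size_parameters :: "real \<Rightarrow> real \<Rightarrow> nat \<Rightarrow> nat \<Rightarrow> real \<Rightarrow> bool" where
  "size_parameters k q n d c \<longleftrightarrow>
     1 \<le> d \<and> 1 \<le> c \<and> real n = 1 + (\<Sum>j<d - 1. k * q ^ j) + k * q ^ (d - 1) / c"

end

theory Submission
  imports Defs "Jordan_Normal_Form.Schur_Decomposition"
begin

text \<open>The matrix \<open>F\<^sub>i(A)\<close> counts nonbacktracking walks of length \<open>i\<close>, so its entries are nonnegative
  integers. Let \<open>g = \<Sum>\<^bsub>i<d\<^esub> c F\<^sub>i + F\<^sub>d\<close> with largest zero \<open>\<lambda>\<close>. By a Christoffel--Darboux identity,
  \<open>g / (x - \<lambda>)\<close> is a combination \<open>h\<close> of \<open>F\<^sub>0, \<dots>, F\<^bsub>d-1\<^esub>\<close> with positive coefficients. The choice of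
  \<open>(d, c)\<close> means \<open>g(k) = c n\<close>, and integrality gives
  \<open>tr (g(A) h(A)) \<ge> c n h(k) = g(k) h(k)\<close>, that is, \<open>(\<tau> - \<lambda>) h(\<tau>)\<^sup>2\<close> has a nonnegative sum over all
  eigenvalues \<open>\<tau>\<close> but one copy of \<open>k\<close>. If \<open>\<tau>\<^sub>2 < \<lambda>\<close>, they are all zeros of \<open>h\<close>, so \<open>h(A)\<close> is a nonzero
  multiple of the all-ones matrix \<open>J\<close>, which is impossible as balls of radius \<open>d - 1\<close> have fewer than
  \<open>n\<close> points. If \<open>\<tau>\<^sub>2 = \<lambda>\<close>, they are all zeros of \<open>g\<close>, so \<open>g(A) = c J\<close>; by integrality this
  describes exactly the generalized Moore geometries.\<close>

section \<open>Real symmetric matrices\<close>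

text \<open>No orthonormal eigenbasis is constructed. Only traces of products of polynomials in
  \<open>A\<close> occur, and for these a common triangularization with real diagonal suffices.
  Orthogonality to the all-ones vector is recovered from Frobenius norms: the squares of the entries
  of \<open>p(A) - p(k)/n J\<close> add up to the sum of \<open>p(e)^2\<close> over all eigenvalues
  \<open>e\<close> but one copy of \<open>k\<close>. So \<open>p\<close> vanishes on these if and
  only if \<open>p(A) = p(k)/n J\<close>. As a single copy of \<open>k\<close> is set aside, the
  argument covers disconnected hypergraphs, where \<open>k\<close> recurs.

  The recurrence of the \<open>F_i\<close> starts with an exceptional coefficient
  \<open>r(u-1)\<close>. The partial sums \<open>G_j = F_0 + ... + F_j\<close> satisfy one with
  constant coefficients, and \<open>g = G_d + (c-1) G_(d-1)\<close>. In the Christoffel-Darboux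
  identity for the \<open>G_j\<close>, setting one variable to the zero \<lambda> of
  \<open>g\<close> turns the right-hand side into a multiple of \<open>g\<close>; this produces
  \<open>h\<close>. Its coefficients are positive because \<lambda> lies beyond all zeros of
  \<open>G_0, ..., G_(d-1)\<close>.\<close>

lemma eigenvalue_real_symmetric_mat:
  fixes A :: "real mat" and z :: complex
  assumes A: "A \<in> carrier_mat n n"
    and sym: "\<And>i j. i < n \<Longrightarrow> j < n \<Longrightarrow> A $$ (i, j) = A $$ (j, i)"
    and ev: "eigenvalue (map_mat complex_of_real A) z"
  shows "z \<in> \<real>"
proof -
  let ?C = "map_mat complex_of_real A"
  obtain v where v: "v \<in> carrier_vec n" "v \<noteq> 0\<^sub>v n" and eq: "?C *\<^sub>v v = z \<cdot>\<^sub>v v"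
    using ev A unfolding eigenvalue_def eigenvector_def by auto
  have row: "(\<Sum>j<n. of_real (A $$ (i, j)) * v $ j) = z * v $ i" if "i < n" for i
  proof -
    have "(?C *\<^sub>v v) $ i = (\<Sum>j<n. of_real (A $$ (i, j)) * v $ j)"
      using that A v by (auto simp: scalar_prod_def atLeast0LessThan intro!: sum.cong)
    then show ?thesis using eq that v by simp
  qed
  \<comment> \<open>The Hermitian form \<open>v^* A v\<close>: it is \<open>z\<close> times the
    squared norm of \<open>v\<close>, and equals its own conjugate by symmetry.\<close>
  define S where "S = (\<Sum>i<n. \<Sum>j<n. of_real (A $$ (i, j)) * v $ j * cnj (v $ i))"
  have N: "(\<Sum>i<n. v $ i * cnj (v $ i)) = of_real (\<Sum>i<n. (cmod (v $ i))\<^sup>2)"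
    unfolding of_real_sum complex_norm_square ..
  have S: "S = z * of_real (\<Sum>i<n. (cmod (v $ i))\<^sup>2)"
    unfolding S_def N[symmetric] sum_distrib_left
    by (intro sum.cong refl, subst sum_distrib_right[symmetric], subst row) auto
  have "cnj S = (\<Sum>i<n. \<Sum>j<n. of_real (A $$ (i, j)) * v $ i * cnj (v $ j))"
    unfolding S_def by (simp add: mult_ac)
  also have "\<dots> = (\<Sum>j<n. \<Sum>i<n. of_real (A $$ (i, j)) * v $ i * cnj (v $ j))"
    by (rule sum.swap)
  also have "\<dots> = S"
    unfolding S_def by (intro sum.cong refl) (simp add: sym)
  finally have real: "cnj S = S" .
  obtain i where i: "i < n" "v $ i \<noteq> 0"
    using v by (metis eq_vecI carrier_vecD index_zero_vec)
  have "(\<Sum>i<n. (cmod (v $ i))\<^sup>2) > 0"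
    using i by (intro sum_pos2[of _ i]) auto
  then have "cnj z = z"
    using real unfolding S by (simp del: of_real_sum)
  then show ?thesis
    by (metis Reals_cnj_iff)
qed

text \<open>All roots of the complex factorization are real, so it descends along the injective
  embedding of the real polynomials.\<close>

lemma char_poly_real_symmetric_mat:
  fixes A :: "real mat"
  assumes A: "A \<in> carrier_mat n n"
    and sym: "\<And>i j. i < n \<Longrightarrow> j < n \<Longrightarrow> A $$ (i, j) = A $$ (j, i)"
  obtains es where "char_poly A = (\<Prod>a\<leftarrow>es. [:- a, 1:])" "length es = n"
proof -
  let ?C = "map_mat complex_of_real A"
  have C: "?C \<in> carrier_mat n n" using A by simp
  obtain zs where zs: "char_poly ?C = (\<Prod>a\<leftarrow>zs. [:- a, 1:])" "length zs = n"
    using char_poly_factorized[OF C] by blast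
  interpret m: map_poly_inj_idom_hom complex_of_real ..
  have "z \<in> \<real>" if "z \<in> set zs" for z
  proof (rule eigenvalue_real_symmetric_mat[OF A sym])
    show "eigenvalue ?C z"
      unfolding eigenvalue_root_char_poly[OF C] zs poly_prod_list using that
      by (auto simp: prod_list_zero_iff)
  qed
  then have "zs = map complex_of_real (map Re zs)"
    by (auto simp: map_idI of_real_Re)
  then have "map_poly complex_of_real (char_poly A)
      = (\<Prod>a\<leftarrow>map complex_of_real (map Re zs). [:- a, 1:])"
    using zs of_real_hom.char_poly_hom[OF A] by metis
  also have "\<dots> = map_poly complex_of_real (\<Prod>a\<leftarrow>map Re zs. [:- a, 1:])"
    by (induct zs) (simp_all add: m.hom_mult del: mult_pCons_left)
  finally have "char_poly A = (\<Prod>a\<leftarrow>map Re zs. [:- a, 1:])"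
    by simp
  then show ?thesis
    using zs(2) by (intro that[of "map Re zs"]) auto
qed

text \<open>If \<open>P * B * Q\<close> is a Schur decomposition of \<open>A\<close> with diagonal \<open>es\<close>, then \<open>p(A)\<close> is an \<open>M\<close> as
  required here.\<close>

definition triangular_conj ::
    "real mat \<Rightarrow> real mat \<Rightarrow> real list \<Rightarrow> real poly \<Rightarrow> real mat \<Rightarrow> bool" where
  "triangular_conj P Q es p M \<longleftrightarrow> (\<exists>T \<in> carrier_mat (length es) (length es).
     upper_triangular T \<and> (\<forall>i<length es. T $$ (i, i) = poly p (es ! i)) \<and> M = P * T * Q)"

lemma upper_triangular_mult:
  fixes S T :: "'a :: semiring_0 mat"
  assumes S: "S \<in> carrier_mat n n" "upper_triangular S"
    and T: "T \<in> carrier_mat n n" "upper_triangular T"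
  shows "upper_triangular (S * T)"
    and "i < n \<Longrightarrow> (S * T) $$ (i, i) = S $$ (i, i) * T $$ (i, i)"
proof -
  have entry: "(S * T) $$ (i, j) = (\<Sum>l<n. S $$ (i, l) * T $$ (l, j))" if "i < n" "j < n" for i j
    using that S(1) T(1) by (auto simp: scalar_prod_def atLeast0LessThan intro!: sum.cong)
  have z: "S $$ (i, l) * T $$ (l, j) = 0" if "i < n" "j < n" "l < n" "j \<le> i" "l \<noteq> i \<or> j < i" for i j l
  proof (cases "l < i")
    case True
    then show ?thesis using S that by (auto dest!: upper_triangularD)
  next
    case False
    then show ?thesis using T that by (auto dest!: upper_triangularD[of T j l])
  qed
  show "upper_triangular (S * T)"
  proof (rule upper_triangularI)
    fix i j assume "j < i" "i < dim_row (S * T)"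
    then show "(S * T) $$ (i, j) = 0"
      using S(1) z[of i j] by (subst entry) (auto intro!: sum.neutral)
  qed
  assume i: "i < n"
  have "(\<Sum>l<n. S $$ (i, l) * T $$ (l, i)) = (\<Sum>l\<in>{i}. S $$ (i, l) * T $$ (l, i))"
    by (rule sum.mono_neutral_right) (use i z[of i i] in auto)
  then show "(S * T) $$ (i, i) = S $$ (i, i) * T $$ (i, i)"
    using entry[OF i i] by simp
qed

text \<open>Polynomials in one matrix are triangularized by the same \<open>P\<close> and
  \<open>Q\<close>. Sums and products of triangular matrices act entrywise on the diagonals, which
  is all that traces see.\<close>

locale triangularizing =
  fixes P Q :: "real mat" and es :: "real list" and n :: nat
  assumes P: "P \<in> carrier_mat n n" and Q: "Q \<in> carrier_mat n n"
    and PQ: "P * Q = 1\<^sub>m n" and QP: "Q * P = 1\<^sub>m n" and len: "length es = n"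
begin

lemma one: "triangular_conj P Q es 1 (1\<^sub>m n)"
  unfolding triangular_conj_def using P PQ len by (intro bexI[of _ "1\<^sub>m n"]) auto

lemma mult:
  assumes "triangular_conj P Q es p M" "triangular_conj P Q es p' M'"
  shows "triangular_conj P Q es (p * p') (M * M')"
proof -
  obtain T T' where T: "T \<in> carrier_mat n n" "upper_triangular T"
      "\<And>i. i < n \<Longrightarrow> T $$ (i, i) = poly p (es ! i)" "M = P * T * Q"
    and T': "T' \<in> carrier_mat n n" "upper_triangular T'"
      "\<And>i. i < n \<Longrightarrow> T' $$ (i, i) = poly p' (es ! i)" "M' = P * T' * Q"
    using assms unfolding triangular_conj_def len by auto
  have "M * M' = P * T * (Q * P) * (T' * Q)"
    using T(1) T'(1) P Q unfolding T(4) T'(4) by (simp add: assoc_mult_mat[of _ n n _ n _ n])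
  also have "\<dots> = P * (T * T') * Q"
    unfolding QP using T(1) T'(1) P Q by (simp add: assoc_mult_mat[of _ n n _ n _ n])
  finally show ?thesis
    unfolding triangular_conj_def len using T T' upper_triangular_mult[OF T(1,2) T'(1,2)]
    by (intro bexI[of _ "T * T'"]) auto
qed

lemma lincomb:
  assumes "triangular_conj P Q es p M" "triangular_conj P Q es p' M'"
  shows "triangular_conj P Q es (Polynomial.smult a p + Polynomial.smult b p')
    (a \<cdot>\<^sub>m M + b \<cdot>\<^sub>m M')"
proof -
  obtain T T' where T: "T \<in> carrier_mat n n" "upper_triangular T"
      "\<And>i. i < n \<Longrightarrow> T $$ (i, i) = poly p (es ! i)" "M = P * T * Q"
    and T': "T' \<in> carrier_mat n n" "upper_triangular T'"
      "\<And>i. i < n \<Longrightarrow> T' $$ (i, i) = poly p' (es ! i)" "M' = P * T' * Q"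
    using assms unfolding triangular_conj_def len by auto
  have "P * (a \<cdot>\<^sub>m T + b \<cdot>\<^sub>m T') * Q = a \<cdot>\<^sub>m M + b \<cdot>\<^sub>m M'"
    using T(1) T'(1) P Q unfolding T(4) T'(4)
    by (simp add: mult_add_distrib_mat[of _ n n _ n] add_mult_distrib_mat[of _ n n _ _ n]
        mult_smult_distrib[of _ n n _ n] mult_smult_assoc_mat[of _ n n _ n])
  moreover have "upper_triangular (a \<cdot>\<^sub>m T + b \<cdot>\<^sub>m T')"
    using T(1,2) T'(1,2) by (auto simp: upper_triangular_def)
  ultimately show ?thesis
    unfolding triangular_conj_def len using T T'
    by (intro bexI[of _ "a \<cdot>\<^sub>m T + b \<cdot>\<^sub>m T'"]) auto
qed

lemma trace:
  assumes "triangular_conj P Q es p M"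
  shows "(\<Sum>i<n. M $$ (i, i)) = (\<Sum>i<n. poly p (es ! i))"
proof -
  obtain T where T: "T \<in> carrier_mat n n"
      "\<And>i. i < n \<Longrightarrow> T $$ (i, i) = poly p (es ! i)" "M = P * T * Q"
    using assms unfolding triangular_conj_def len by auto
  have tr: "(\<Sum>i<n. (X * Y) $$ (i, i)) = (\<Sum>i<n. (Y * X) $$ (i, i))"
    if X: "X \<in> carrier_mat n n" and Y: "Y \<in> carrier_mat n n" for X Y :: "real mat"
  proof -
    have e: "(X * Y) $$ (i, i) = (\<Sum>j<n. X $$ (i, j) * Y $$ (j, i))"
      if "X \<in> carrier_mat n n" "Y \<in> carrier_mat n n" "i < n" for i and X Y :: "real mat"
      using that by (auto simp: scalar_prod_def atLeast0LessThan intro!: sum.cong)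
    have "(\<Sum>i<n. (X * Y) $$ (i, i)) = (\<Sum>i<n. \<Sum>j<n. X $$ (i, j) * Y $$ (j, i))"
      by (intro sum.cong refl e X Y) auto
    also have "\<dots> = (\<Sum>j<n. \<Sum>i<n. Y $$ (j, i) * X $$ (i, j))"
      by (subst sum.swap) (simp add: mult.commute)
    also have "\<dots> = (\<Sum>i<n. (Y * X) $$ (i, i))"
      by (intro sum.cong refl e[symmetric] X Y) auto
    finally show ?thesis .
  qed
  have "(\<Sum>i<n. M $$ (i, i)) = (\<Sum>i<n. (Q * (P * T)) $$ (i, i))"
    unfolding T(3) by (rule tr) (use P Q T in auto)
  also have "Q * (P * T) = T"
    using assoc_mult_mat[OF Q P T(1)] QP T(1) by simp
  finally show ?thesis using T(2) by simp
qed

end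

lemma triangularizing_exists:
  fixes A :: "real mat"
  assumes A: "A \<in> carrier_mat n n" and split: "char_poly A = (\<Prod>a\<leftarrow>es. [:- a, 1:])"
    and len: "length es = n"
  obtains P Q where "triangularizing P Q es n" "triangular_conj P Q es [:0, 1:] A"
proof -
  obtain B P Q where B: "schur_decomposition A es = (B, P, Q)"
    by (metis prod_cases3)
  note s = schur_decomposition[OF A split B]
  then have w: "similar_mat_wit A B P Q" and ut: "upper_triangular B" and dg: "diag_mat B = es"
    by auto
  note w = similar_mat_witD2[OF A w]
  have "triangularizing P Q es n"
    by unfold_locales (use w len in auto)
  moreover have "B $$ (i, i) = es ! i" if "i < n" for i
    using that w(5) dg[symmetric] by (simp add: diag_mat_def)
  then have "triangular_conj P Q es [:0, 1:] A"
    unfolding triangular_conj_def len using w ut by (intro bexI[of _ B]) auto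
  ultimately show ?thesis by (rule that)
qed

section \<open>The polynomials\<close>

text \<open>These sums replace the \<open>F_i\<close> in the Christoffel-Darboux identity, because
  their recurrence is regular from the start.\<close>

definition G_poly :: "nat \<Rightarrow> nat \<Rightarrow> nat \<Rightarrow> real poly" where
  "G_poly r u j = (\<Sum>i\<le>j. F_poly r u i)"

definition quasi_poly :: "nat \<Rightarrow> nat \<Rightarrow> nat \<Rightarrow> real \<Rightarrow> real poly" where
  "quasi_poly r u d c = (\<Sum>i<d. Polynomial.smult c (F_poly r u i)) + F_poly r u d"

text \<open>The quadratic \<open>F_2\<close> fits the later recurrence with \<open>r(u-1)\<close>
  for \<open>(r-1)(u-1)\<close>: a walk of length 0 has no last hyperedge to avoid.\<close>

lemma F_poly_Suc:
  assumes "i \<ge> 1"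
  shows "F_poly r u (Suc i) = [:- (real u - 2), 1:] * F_poly r u i
    - Polynomial.smult (if i = 1 then real r * (real u - 1) else (real r - 1) * (real u - 1))
        (F_poly r u (i - 1))"
proof (cases "i = 1")
  case False
  then obtain j where "i = Suc (Suc j)"
    using assms by (metis One_nat_def Suc_le_D le_antisym not_less_eq_eq)
  then show ?thesis by simp
qed (simp)

lemma degree_lead_coeff_F_poly:
  "degree (F_poly r u i) = i \<and> lead_coeff (F_poly r u i) = 1"
proof (induct r u i rule: F_poly.induct)
  case (4 r u i)
  let ?p = "F_poly r u (Suc (Suc i))" and ?q = "F_poly r u (Suc i)"
  have p: "?p \<noteq> 0" using 4(1) by auto
  have d: "degree ([:- (real u - 2), 1:] * ?p) = Suc (Suc (Suc i))"
    using p 4(1) by (subst degree_mult_eq) auto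
  have l: "lead_coeff ([:- (real u - 2), 1:] * ?p) = 1"
    using 4(1) unfolding lead_coeff_mult by auto
  have dq: "degree (Polynomial.smult ((real r - 1) * (real u - 1)) ?q) < Suc (Suc (Suc i))"
    using 4(2) degree_smult_le[of "(real r - 1) * (real u - 1)" ?q] by simp
  have "degree (F_poly r u (Suc (Suc (Suc i)))) = Suc (Suc (Suc i))"
    using d dq by (simp only: F_poly.simps diff_conv_add_uminus) (subst degree_add_eq_left, auto)
  moreover have "coeff (F_poly r u (Suc (Suc (Suc i)))) (Suc (Suc (Suc i))) = 1"
    using l unfolding d F_poly.simps coeff_diff coeff_eq_0[OF dq] by simp
  ultimately show ?case by simp
qed auto

lemma degree_F_poly [simp]: "degree (F_poly r u i) = i"
  and coeff_F_poly [simp]: "coeff (F_poly r u i) i = 1"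
  using degree_lead_coeff_F_poly[of r u i] by auto

lemma G_poly_eq_F_poly_plus: "G_poly r u (Suc j) = G_poly r u j + F_poly r u (Suc j)"
  by (simp add: G_poly_def)

lemma quasi_poly_eq_G_poly:
  assumes "d \<ge> 1"
  shows "quasi_poly r u d c = G_poly r u d + Polynomial.smult (c - 1) (G_poly r u (d - 1))"
proof -
  obtain e where "d = Suc e" using assms by (cases d) auto
  then show ?thesis
    by (simp add: quasi_poly_def G_poly_def lessThan_Suc_atMost smult_sum2 smult_diff_left sum_subtractf)
qed

lemma degree_sum_F_poly_le: "degree (\<Sum>i<d. Polynomial.smult (a i) (F_poly r u i)) \<le> d - 1"
  by (rule degree_sum_le)
    (auto intro: order_trans[OF degree_smult_le] )

lemma degree_lead_coeff_quasi_poly: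
  assumes "d \<ge> 1"
  shows "degree (quasi_poly r u d c) = d" "lead_coeff (quasi_poly r u d c) = 1"
proof -
  have l: "degree (\<Sum>i<d. Polynomial.smult c (F_poly r u i)) < d"
    using degree_sum_F_poly_le[of "\<lambda>_. c" r u d] assms by simp
  then show d: "degree (quasi_poly r u d c) = d"
    unfolding quasi_poly_def
    by (subst degree_add_eq_right) (auto )
  show "lead_coeff (quasi_poly r u d c) = 1"
    unfolding d unfolding quasi_poly_def
    using coeff_eq_0[OF l] by simp
qed

section \<open>Values and largest zeros of the polynomials, and the kernel\<close>

context
  fixes r u :: nat and q :: real
  assumes ru: "r \<ge> 2" "u \<ge> 2" and q: "q = (real r - 1) * (real u - 1)"
begin

lemma q_ge_1: "q \<ge> 1"
  using mult_mono[of 1 "real r - 1" 1 "real u - 1"] ru by (simp add: q)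

lemma poly_F_Suc:
  "i \<ge> 1 \<Longrightarrow> poly (F_poly r u (Suc i)) x = (x - (real u - 2)) * poly (F_poly r u i) x
     - (if i = 1 then real r * (real u - 1) else q) * poly (F_poly r u (i - 1)) x"
  by (simp add: F_poly_Suc q algebra_simps)

text \<open>The recurrences of the \<open>F_i\<close> are added up. The exceptional coefficient is
  absorbed at the start, since \<open>1 - r(u-1) = -(u-2) - q\<close>.\<close>

lemma poly_G_Suc:
  "poly (G_poly r u (Suc (Suc j))) x
     = (x - real u + 2) * poly (G_poly r u (Suc j)) x - q * poly (G_poly r u j) x"
proof (induct j)
  case 0
  then show ?case by (simp add: G_poly_def q algebra_simps)
next
  case (Suc j)
  have "poly (F_poly r u (Suc (Suc (Suc j)))) x = (x - real u + 2) * poly (F_poly r u (Suc (Suc j))) x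
     - q * poly (F_poly r u (Suc j)) x"
    using poly_F_Suc[of "Suc (Suc j)" x] by (simp add: algebra_simps)
  then show ?case
    using Suc by (simp add: G_poly_eq_F_poly_plus algebra_simps)
qed

text \<open>Since \<open>k - (u-2) = q + 1\<close>, the recurrence at \<open>k\<close> has the
  characteristic roots 1 and \<open>q\<close>. The value counts the nonbacktracking walks of length
  \<open>i\<close> from a fixed vertex.\<close>

lemma poly_F_at_degree:
  assumes "i \<ge> 1" and k: "k = real r * (real u - 1)"
  shows "poly (F_poly r u i) k = k * q ^ (i - 1)"
  using assms(1)
proof (induct i rule: less_induct)
  case (less i)
  have kq: "k - (real u - 2) = q + 1" by (simp add: k q algebra_simps)
  consider "i = 1" | "i = 2" | j where "i = Suc (Suc (Suc j))"
    using less(2) by (metis One_nat_def Suc_1 Suc_le_D le_antisym not_less_eq_eq not0_implies_Suc)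
  then show ?case
  proof cases
    case 2
    have "poly (F_poly r u 2) k = (q + 1) * k - k"
      using poly_F_Suc[of 1 k, unfolded kq]
      by (simp add: numeral_2_eq_2 k[symmetric] del: F_poly.simps(3))
    then show ?thesis
      unfolding 2 by (simp add: algebra_simps)
  next
    case (3 j)
    show ?thesis
      using poly_F_Suc[of "Suc (Suc j)" k, unfolded kq] less(1)[of "Suc j"] less(1)[of "Suc (Suc j)"]
      unfolding 3 by (simp add: algebra_simps)
  qed simp
qed

lemma poly_F_pos:
  assumes "k = real r * (real u - 1)"
  shows "poly (F_poly r u i) k > 0"
proof (cases "i = 0")
  case False
  then show ?thesis
    using poly_F_at_degree[of i, OF _ assms] q_ge_1 ru assms by simp
qed (simp add: assms)

text \<open>Up to a constant factor, \<open>q^j\<close> is the squared norm of \<open>G_j\<close>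
  for the orthogonality belonging to the recurrence; the usual weights \<open>1/q^j\<close> are
  scaled by \<open>q^m\<close>.\<close>

lemma christoffel_darboux:
  "(x - y) * (\<Sum>j\<le>m. q ^ (m - j) * poly (G_poly r u j) y * poly (G_poly r u j) x)
     = poly (G_poly r u (Suc m)) x * poly (G_poly r u m) y
       - poly (G_poly r u m) x * poly (G_poly r u (Suc m)) y"
proof (induct m)
  case 0
  show ?case by (simp add: G_poly_def)
next
  case (Suc m)
  let ?K = "\<lambda>m. \<Sum>j\<le>m. q ^ (m - j) * poly (G_poly r u j) y * poly (G_poly r u j) x"
  have "(\<Sum>j\<le>m. q ^ (Suc m - j) * poly (G_poly r u j) y * poly (G_poly r u j) x) = q * ?K m"
    unfolding sum_distrib_left by (intro sum.cong) (auto simp: Suc_diff_le)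
  then have "(x - y) * ?K (Suc m) = q * ((x - y) * ?K m)
      + (x - y) * poly (G_poly r u (Suc m)) y * poly (G_poly r u (Suc m)) x"
    by (simp add: algebra_simps)
  then show ?case
    unfolding Suc poly_G_Suc by (simp add: algebra_simps)
qed

lemma poly_zero_right_of_neg:
  fixes p :: "real poly"
  assumes "lead_coeff p > 0" "poly p a < 0"
  obtains z where "z > a" "poly p z = 0" "\<And>x. x > z \<Longrightarrow> poly p x > 0"
proof -
  have p: "p \<noteq> 0" using assms by auto
  obtain b where b: "\<And>x. x \<ge> b \<Longrightarrow> poly p x \<ge> lead_coeff p"
    using poly_pinfty_gt_lc[OF assms(1)] by blast
  define R where "R = {x. poly p x = 0}"
  have fin: "finite R" unfolding R_def by (rule poly_roots_finite[OF p])
  have ivt: "\<exists>z\<ge>x. z \<in> R" if "poly p x \<le> 0" for x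
  proof -
    have m: "poly p (max x b) > 0" using b[of "max x b"] assms(1) by simp
    show ?thesis
    proof (cases "poly p x = 0")
      case False
      then have "x < max x b" "poly p x < 0"
        using m that by (auto simp: less_le max_def split: if_splits)
      then show ?thesis
        using poly_IVT_pos[of x "max x b" p] m unfolding R_def by (auto intro: less_imp_le)
    qed (auto simp: R_def)
  qed
  then have ne: "R \<noteq> {}" using assms(2) by (meson empty_iff less_imp_le)
  show ?thesis
  proof
    show z: "poly p (Max R) = 0" using Max_in[OF fin ne] by (simp add: R_def)
    obtain z where "z \<ge> a" "z \<in> R" using ivt assms(2) by (meson less_imp_le)
    then have "a \<le> Max R" using Max_ge[OF fin] order_trans by blast
    moreover have "a \<noteq> Max R" using z assms(2) by auto
    ultimately show "a < Max R" by simp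
    show "poly p x > 0" if "x > Max R" for x
    proof (rule ccontr)
      assume "\<not> ?thesis"
      then obtain z where "z \<ge> x" "z \<in> R" using ivt by (metis not_less)
      then show False using Max_ge[OF fin] that by force
    qed
  qed
qed

lemma lead_coeff_G_poly: "lead_coeff (G_poly r u j) = 1"
proof (cases j)
  case (Suc i)
  then show ?thesis
    using degree_lead_coeff_quasi_poly(2)[of j r u 1] quasi_poly_eq_G_poly[of j r u 1] by simp
qed (simp add: G_poly_def)

text \<open>At the largest zero \<open>z\<close> of \<open>G_(m+1)\<close> the recurrence gives
  \<open>G_(m+2)(z) = -q G_m(z) < 0\<close>, so the largest zeros move strictly to the
  right.\<close>

lemma G_poly_largest_zero:
  obtains z where "poly (G_poly r u (Suc m)) z = 0" "\<And>x i. i \<le> m \<Longrightarrow> x \<ge> z \<Longrightarrow> poly (G_poly r u i) x > 0"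
    "\<And>x. x > z \<Longrightarrow> poly (G_poly r u (Suc m)) x > 0"
proof (induct m arbitrary: thesis)
  case 0
  show ?case by (rule 0[of "-1"]) (auto simp: G_poly_def)
next
  case (Suc m)
  obtain z where z: "poly (G_poly r u (Suc m)) z = 0" "\<And>x i. i \<le> m \<Longrightarrow> x \<ge> z \<Longrightarrow> poly (G_poly r u i) x > 0"
    "\<And>x. x > z \<Longrightarrow> poly (G_poly r u (Suc m)) x > 0"
    using Suc(1) by blast
  have "poly (G_poly r u (Suc (Suc m))) z < 0"
    using z(1) z(2)[of m z] q_ge_1 by (simp add: poly_G_Suc)
  then obtain y where y: "y > z" "poly (G_poly r u (Suc (Suc m))) y = 0"
    "\<And>x. x > y \<Longrightarrow> poly (G_poly r u (Suc (Suc m))) x > 0"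
    by (rule poly_zero_right_of_neg[rotated]) (auto simp: lead_coeff_G_poly)
  show ?case
  proof (rule Suc(2)[OF y(2) _ y(3)])
    show "poly (G_poly r u i) x > 0" if "i \<le> Suc m" "x \<ge> y" for i x
      using z(2)[of i x] z(3)[of x] that y(1) by (cases "i = Suc m") auto
  qed
qed

lemma lambda_dc:
  fixes c :: real
  assumes "d \<ge> 1"
  defines "l \<equiv> lambda_dc r u d c"
  shows "poly (quasi_poly r u d c) l = 0"
    and "poly (quasi_poly r u d c) x = 0 \<Longrightarrow> x \<le> l"
    and "i < d \<Longrightarrow> poly (G_poly r u i) l > 0"
proof -
  let ?g = "quasi_poly r u d c"
  have l: "l = Max {x. poly ?g x = 0}"
    unfolding l_def lambda_dc_def quasi_poly_def ..
  have fin: "finite {x. poly ?g x = 0}"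
    using degree_lead_coeff_quasi_poly(2)[OF assms(1), of r u c] by (intro poly_roots_finite) auto
  obtain e where e: "d = Suc e" using assms by (cases d) auto
  \<comment> \<open>It is enough to find some zero of \<open>g\<close> from which on all these
    \<open>G_i\<close> are positive: the largest zero is not to the left of it.\<close>
  have "\<exists>x. poly ?g x = 0 \<and> (\<forall>y\<ge>x. \<forall>i<d. poly (G_poly r u i) y > 0)"
  proof (cases e)
    case 0
    then show ?thesis
      by (intro exI[of _ "- c"]) (auto simp: e quasi_poly_def G_poly_def)
  next
    case (Suc m)
    obtain z where z: "poly (G_poly r u (Suc m)) z = 0" "\<And>x i. i \<le> m \<Longrightarrow> x \<ge> z \<Longrightarrow> poly (G_poly r u i) x > 0"
      "\<And>x. x > z \<Longrightarrow> poly (G_poly r u (Suc m)) x > 0"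
      using G_poly_largest_zero by blast
    \<comment> \<open>Here \<open>z\<close> is the largest zero of \<open>G_(d-1)\<close>, so
      \<open>g(z) = G_d(z) = -q G_(d-2)(z)\<close>.\<close>
    have "poly ?g z < 0"
      using z(1) z(2)[of m z] q_ge_1 quasi_poly_eq_G_poly[of d r u c] by (simp add: e Suc poly_G_Suc)
    then obtain y where y: "y > z" "poly ?g y = 0"
      by (rule poly_zero_right_of_neg[rotated]) (auto simp: degree_lead_coeff_quasi_poly(2)[OF assms(1)])
    have "poly (G_poly r u i) x > 0" if "x \<ge> y" "i < d" for x i
      using that y z(2)[of i x] z(3)[of x] e Suc by (cases "i = Suc m") auto
    then show ?thesis using y by blast
  qed
  then obtain x0 where x0: "poly ?g x0 = 0" "\<And>y i. y \<ge> x0 \<Longrightarrow> i < d \<Longrightarrow> poly (G_poly r u i) y > 0"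
    by blast
  then show "poly ?g l = 0" using Max_in[OF fin] l by blast
  show le: "x \<le> l" if "poly ?g x = 0" for x
    unfolding l using Max_ge[OF fin] that by blast
  show "i < d \<Longrightarrow> poly (G_poly r u i) l > 0"
    using x0(2) le[OF x0(1)] by blast
qed

text \<open>Take \<open>y\<close> = \<lambda> in \<open>christoffel_darboux\<close>. As
  \<open>G_d(\<lambda>) = -(c-1) G_(d-1)(\<lambda>)\<close>, the right-hand side becomes
  \<open>G_(d-1)(\<lambda>) g(x)\<close>, which gives \<gamma>.\<close>

lemma kernel_at_lambda_dc:
  assumes d: "d \<ge> 1"
  obtains a :: "nat \<Rightarrow> real" and \<gamma> :: real
  where "\<gamma> > 0" "\<And>i. i < d \<Longrightarrow> a i > 0"
    "\<And>x. (x - lambda_dc r u d c) * (\<Sum>i<d. a i * poly (F_poly r u i) x) = \<gamma> * poly (quasi_poly r u d c) x"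
proof -
  define l where "l = lambda_dc r u d c"
  obtain m where m: "d = Suc m" using d by (cases d) auto
  define b where "b j = q ^ (m - j) * poly (G_poly r u j) l" for j
  have pos: "poly (G_poly r u i) l > 0" if "i \<le> m" for i
    using lambda_dc(3)[OF d] that m l_def by auto
  then have b: "b j > 0" if "j \<le> m" for j
    using q_ge_1 that by (simp add: b_def)
  \<comment> \<open>Expanding each \<open>G_j\<close> into the \<open>F_i\<close> collects at
    \<open>F_i\<close> the weights of all \<open>j \<ge> i\<close>.\<close>
  define a where "a i = (\<Sum>j\<in>{i..m}. b j)" for i
  have "(\<Sum>j\<le>m. b j * poly (G_poly r u j) x) = (\<Sum>i<d. a i * poly (F_poly r u i) x)" for x
  proof -
    have "(\<Sum>j\<le>m. b j * poly (G_poly r u j) x) = (\<Sum>j\<le>m. \<Sum>i\<le>j. b j * poly (F_poly r u i) x)"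
      by (simp add: G_poly_def poly_sum sum_distrib_left)
    also have "\<dots> = (\<Sum>i\<le>m. \<Sum>j\<in>{i..m}. b j * poly (F_poly r u i) x)"
      unfolding sum.Sigma[OF finite_atMost ballI[OF finite_atMost]]
        sum.Sigma[OF finite_atMost ballI[OF finite_atLeastAtMost]]
      by (rule sum.reindex_bij_witness[of _ prod.swap prod.swap]) auto
    finally show ?thesis by (simp add: a_def sum_distrib_right m lessThan_Suc_atMost)
  qed
  note H = this
  have g0: "poly (G_poly r u (Suc m)) l = - (c - 1) * poly (G_poly r u m) l"
    using lambda_dc(1)[OF d, of c] unfolding l_def[symmetric] quasi_poly_eq_G_poly[OF d]
    by (simp add: m algebra_simps)
  show ?thesis
  proof
    show "poly (G_poly r u m) l > 0" by (rule pos) simp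
    show "a i > 0" if "i < d" for i
      unfolding a_def using that m b by (intro sum_pos) auto
    show "(x - lambda_dc r u d c) * (\<Sum>i<d. a i * poly (F_poly r u i) x)
        = poly (G_poly r u m) l * poly (quasi_poly r u d c) x" for x
      unfolding H[symmetric] l_def[symmetric] b_def christoffel_darboux g0 quasi_poly_eq_G_poly[OF d]
      by (simp add: m algebra_simps)
  qed
qed

end

section \<open>Existence and uniqueness of the pair \<open>(d, c)\<close>\<close>

lemma size_parameters_ex1:
  assumes k: "k > 0" and q: "q \<ge> 1" and n: "n \<ge> 2"
  shows "\<exists>!p. size_parameters k q n (fst p) (snd p)"
proof -
  define N where "N e = 1 + (\<Sum>j<e. k * q ^ j)" for e :: nat
  have pos: "k * q ^ e \<ge> k" for e
    using k q by (simp add: one_le_power)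
  have N_Suc: "N (Suc e) = N e + k * q ^ e" for e by (simp add: N_def)
  have N_mono: "strict_mono N"
    unfolding strict_mono_Suc_iff N_Suc using pos k by (metis less_add_same_cancel1 less_le_trans)
  have N_ge: "N e \<ge> 1 + real e * k" for e
    using pos by (induct e) (auto simp: N_Suc algebra_simps N_def intro: add_mono)
  \<comment> \<open>Solving for \<open>c\<close> shows that \<open>c \<ge> 1\<close> means
    \<open>n \<le> N d\<close>, so \<open>d\<close> is determined by the interval between
    consecutive values of \<open>N\<close> that contains \<open>n\<close>.\<close>
  have iff: "size_parameters k q n d c \<longleftrightarrow>
      1 \<le> d \<and> N (d - 1) < real n \<and> real n \<le> N d \<and> c = k * q ^ (d - 1) / (real n - N (d - 1))" for d c
  proof (cases d)
    case (Suc e)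
    have P: "0 < k * q ^ e" using pos[of e] k by simp
    have "1 \<le> c \<and> real n = N e + k * q ^ e / c \<longleftrightarrow>
        N e < real n \<and> real n \<le> N e + k * q ^ e \<and> c = k * q ^ e / (real n - N e)"
    proof
      assume c: "1 \<le> c \<and> real n = N e + k * q ^ e / c"
      then have "k * q ^ e / c \<le> k * q ^ e / 1" using P by (intro divide_left_mono) auto
      then show "N e < real n \<and> real n \<le> N e + k * q ^ e \<and> c = k * q ^ e / (real n - N e)"
        using c k q by simp
    next
      assume "N e < real n \<and> real n \<le> N e + k * q ^ e \<and> c = k * q ^ e / (real n - N e)"
      then show "1 \<le> c \<and> real n = N e + k * q ^ e / c"
        using P k q by simp
    qed
    then show ?thesis
      unfolding size_parameters_def Suc N_Suc by (simp add: N_def)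
  qed (simp add: size_parameters_def)
  obtain e where "real n - 1 < real e * k"
    using k reals_Archimedean3 by blast
  then have ex: "real n \<le> N e" using N_ge[of e] by simp
  define d where "d = (LEAST e. real n \<le> N e)"
  have d: "real n \<le> N d" unfolding d_def using ex by (rule LeastI)
  have less: "N e < real n" if "e < d" for e
    using not_less_Least[OF that[unfolded d_def]] by simp
  \<comment> \<open>Here \<open>n \<ge> 2\<close> enters, as \<open>N 0 = 1\<close>.\<close>
  have d1: "d \<ge> 1"
    using d n by (cases d) (auto simp: N_def)
  show ?thesis
  proof (rule ex1I[of _ "(d, k * q ^ (d - 1) / (real n - N (d - 1)))"])
    show "size_parameters k q n (fst (d, k * q ^ (d - 1) / (real n - N (d - 1))))
        (snd (d, k * q ^ (d - 1) / (real n - N (d - 1))))"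
      unfolding iff fst_conv snd_conv using d d1 less[of "d - 1"] by simp
  next
    fix p assume "size_parameters k q n (fst p) (snd p)"
    then obtain d' c' where p: "p = (d', c')" and s: "1 \<le> d'" "N (d' - 1) < real n" "real n \<le> N d'"
      "c' = k * q ^ (d' - 1) / (real n - N (d' - 1))"
      by (cases p) (auto simp: iff)
    have "d \<le> d'" unfolding d_def using s(3) by (rule Least_le)
    moreover have "d' - 1 < d"
      using s(2) d strict_mono_less[OF N_mono] by fastforce
    ultimately have "d' = d" using d1 by simp
    then show "p = (d, k * q ^ (d - 1) / (real n - N (d - 1)))" using p s by simp
  qed
qed

section \<open>Nonbacktracking walks\<close>

locale regular_uniform_hypergraph =
  fixes V :: "'v set" and E :: "'v set set" and r u :: nat
  assumes hyp: "hypergraph V E" and reg: "regular V E r" and unif: "uniform E u"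
    and r2: "r \<ge> 2" and u2: "u \<ge> 2" and ne: "V \<noteq> {}"
begin

lemma finV: "finite V" and edge_sub: "e \<in> E \<Longrightarrow> e \<subseteq> V"
  using hyp by (auto simp: hypergraph_def)

lemma finE: "finite E"
  using finV edge_sub by (meson Pow_iff finite_Pow_iff finite_subset subsetI)

lemma fin_edge: "e \<in> E \<Longrightarrow> finite e"
  using finV edge_sub finite_subset by blast

lemma card_edge: "e \<in> E \<Longrightarrow> card e = u"
  using unif by (auto simp: uniform_def)

lemma card_edges_at: "x \<in> V \<Longrightarrow> card {e \<in> E. x \<in> e} = r"
  using reg by (auto simp: regular_def)

text \<open>Walks \<open>x, e\<^sub>1, v\<^sub>1, \<dots>, e\<^sub>i, v\<^sub>i = t\<close> with \<open>e\<^sub>j \<noteq> e\<^bsub>j+1\<^esub>\<close> and \<open>v\<^bsub>j-1\<^esub> \<noteq> v\<^sub>j\<close> are called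
  nonbacktracking. Those counted by \<open>nb_avoiding i x t e'\<close> satisfy \<open>e\<^sub>i \<noteq> e'\<close> as well, so that
  they can be continued through \<open>e'\<close>. The matrix \<open>nb_walks i\<close> is \<open>F_poly r u i\<close> evaluated at the
  adjacency matrix.\<close>

primrec nb_avoiding :: "nat \<Rightarrow> 'v \<Rightarrow> 'v \<Rightarrow> 'v set \<Rightarrow> nat" where
  "nb_avoiding 0 x t e' = (if t = x then 1 else 0)"
| "nb_avoiding (Suc i) x t e' =
     (\<Sum>e\<in>{e \<in> E. t \<in> e} - {e'}. \<Sum>s\<in>e - {t}. nb_avoiding i x s e)"

definition nb_walks :: "nat \<Rightarrow> 'v \<Rightarrow> 'v \<Rightarrow> nat" where
  "nb_walks i x y = (case i of 0 \<Rightarrow> if y = x then 1 else 0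
     | Suc j \<Rightarrow> \<Sum>e\<in>{e \<in> E. y \<in> e}. \<Sum>s\<in>e - {y}. nb_avoiding j x s e)"

lemma nb_walks_0 [simp]: "nb_walks 0 x y = (if y = x then 1 else 0)"
  and nb_walks_Suc: "nb_walks (Suc j) x y = (\<Sum>e\<in>{e \<in> E. y \<in> e}. \<Sum>s\<in>e - {y}. nb_avoiding j x s e)"
  by (simp_all add: nb_walks_def)

lemma sum_adjacency:
  assumes "z \<in> V"
  shows "(\<Sum>y\<in>V. h y * adjacency E y z) = (\<Sum>e\<in>{e \<in> E. z \<in> e}. \<Sum>y\<in>e - {z}. h y)"
proof -
  let ?S = "{e \<in> E. z \<in> e}"
  have fS: "finite ?S" using finE by simp
  have "(\<Sum>e\<in>?S. \<Sum>y\<in>e - {z}. h y) = (\<Sum>e\<in>?S. \<Sum>y\<in>V. if y \<in> e - {z} then h y else 0)"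
    by (rule sum.cong[OF refl], rule sum.mono_neutral_cong_left) (use edge_sub finV in auto)
  also have "\<dots> = (\<Sum>y\<in>V. \<Sum>e\<in>?S. if y \<in> e - {z} then h y else 0)"
    by (rule sum.swap)
  also have "\<dots> = (\<Sum>y\<in>V. h y * adjacency E y z)"
  proof (intro sum.cong refl)
    fix y
    have "(\<Sum>e\<in>?S. if y \<in> e - {z} then h y else 0) = h y * card {e \<in> ?S. y \<in> e - {z}}"
      using fS by (simp add: sum.If_cases Int_def)
    also have "card {e \<in> ?S. y \<in> e - {z}} = adjacency E y z"
      by (auto simp: adjacency_def intro!: arg_cong[of _ _ card])
    finally show "(\<Sum>e\<in>?S. if y \<in> e - {z} then h y else 0) = h y * adjacency E y z" .
  qed
  finally show ?thesis by simp
qed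

text \<open>Two successive steps inside one hyperedge from \<open>s\<close> to \<open>z\<close>: a
  point \<open>s\<close> other than \<open>z\<close> has \<open>u-2\<close> choices of the
  intermediate point \<open>y\<close>, and \<open>s = z\<close> has \<open>u-1\<close>.\<close>

lemma sum_minus_point_twice:
  assumes "e \<in> E" "z \<in> e"
  shows "(\<Sum>y\<in>e - {z}. \<Sum>s\<in>e - {y}. h s) = (u - 2) * (\<Sum>s\<in>e - {z}. h s) + (u - 1) * h z"
proof -
  have fe: "finite e" using assms fin_edge by blast
  have "(\<Sum>y\<in>e - {z}. \<Sum>s\<in>e - {y}. h s) = (\<Sum>y\<in>e - {z}. \<Sum>s\<in>e. if s \<noteq> y then h s else 0)"
    by (rule sum.cong[OF refl], rule sum.mono_neutral_cong_left) (use fe in auto)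
  also have "\<dots> = (\<Sum>s\<in>e. \<Sum>y\<in>e - {z}. if s \<noteq> y then h s else 0)"
    by (rule sum.swap)
  also have "\<dots> = (\<Sum>s\<in>e. card {y \<in> e - {z}. s \<noteq> y} * h s)"
    using fe by (intro sum.cong refl) (simp add: sum.If_cases Int_def)
  also have "\<dots> = card {y \<in> e - {z}. z \<noteq> y} * h z + (\<Sum>s\<in>e - {z}. card {y \<in> e - {z}. s \<noteq> y} * h s)"
    using fe assms(2) by (rule sum.remove)
  also have "{y \<in> e - {z}. z \<noteq> y} = e - {z}" by auto
  also have "card (e - {z}) = u - 1" using card_edge assms fe by simp
  also have "(\<Sum>s\<in>e - {z}. card {y \<in> e - {z}. s \<noteq> y} * h s) = (\<Sum>s\<in>e - {z}. (u - 2) * h s)"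
  proof (intro sum.cong refl)
    fix s assume s: "s \<in> e - {z}"
    have "{y \<in> e - {z}. s \<noteq> y} = e - {z} - {s}" by auto
    then show "card {y \<in> e - {z}. s \<noteq> y} * h s = (u - 2) * h s"
      using s fe assms card_edge by (simp add: numeral_2_eq_2)
  qed
  finally show ?thesis by (simp add: sum_distrib_left)
qed

text \<open>A walk of positive length ending at \<open>t\<close> is ruled out by exactly one
  hyperedge at \<open>t\<close>, its last; a walk of length 0 by none.\<close>

lemma sum_nb_avoiding:
  assumes "t \<in> V"
  shows "(\<Sum>e\<in>{e \<in> E. t \<in> e}. nb_avoiding i x t e) = (if i = 0 then r else r - 1) * nb_walks i x t"
proof (cases i)
  case 0
  then show ?thesis using card_edges_at[OF assms] by simp
next
  case (Suc j)
  let ?S = "{e \<in> E. t \<in> e}" and ?h = "\<lambda>e. \<Sum>s\<in>e - {t}. nb_avoiding j x s e"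
  have fS: "finite ?S" using finE by simp
  have "(\<Sum>e'\<in>?S. \<Sum>e\<in>?S - {e'}. ?h e) = (\<Sum>e'\<in>?S. \<Sum>e\<in>?S. if e \<noteq> e' then ?h e else 0)"
    by (rule sum.cong[OF refl], rule sum.mono_neutral_cong_left) (use fS in auto)
  also have "\<dots> = (\<Sum>e\<in>?S. \<Sum>e'\<in>?S. if e \<noteq> e' then ?h e else 0)"
    by (rule sum.swap)
  also have "\<dots> = (\<Sum>e\<in>?S. (r - 1) * ?h e)"
  proof (intro sum.cong refl)
    fix e assume e: "e \<in> ?S"
    have "(\<Sum>e'\<in>?S. if e \<noteq> e' then ?h e else 0) = (\<Sum>e'\<in>?S - {e}. ?h e)"
      by (rule sum.mono_neutral_cong_right) (use fS in auto)
    then show "(\<Sum>e'\<in>?S. if e \<noteq> e' then ?h e else 0) = (r - 1) * ?h e"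
      using e fS card_edges_at[OF assms] by simp
  qed
  finally show ?thesis
    using Suc by (simp add: nb_walks_Suc sum_distrib_left)
qed

lemma nb_walks_1:
  assumes "x \<in> V" "y \<in> V"
  shows "nb_walks 1 x y = adjacency E x y"
proof -
  \<comment> \<open>\<open>nb_avoiding 0\<close> ignores its last argument, so \<open>{}\<close> is
    a placeholder.\<close>
  have "nb_walks 1 x y = (\<Sum>s\<in>V. nb_avoiding 0 x s {} * adjacency E s y)"
    unfolding sum_adjacency[OF assms(2)] One_nat_def nb_walks_Suc by simp
  also have "\<dots> = adjacency E x y"
    using finV assms(1) by (simp add: if_distrib[of "\<lambda>a. a * _"] cong: if_cong)
  finally show ?thesis .
qed

text \<open>A step through \<open>e\<close> extends a walk that ended through another hyperedge. If
  the walk ended through \<open>e\<close>, its last two steps lie in \<open>e\<close> and are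
  replaced by one step in \<open>e\<close> or, on returning, by none.\<close>

lemma nb_walks_step:
  assumes z: "z \<in> V"
  shows "(\<Sum>y\<in>V. nb_walks (Suc j) x y * adjacency E y z) =
     nb_walks (Suc (Suc j)) x z + (u - 2) * nb_walks (Suc j) x z
       + (u - 1) * ((if j = 0 then r else r - 1) * nb_walks j x z)"
proof -
  let ?S = "{e \<in> E. z \<in> e}"
  have split: "nb_walks (Suc j) x y = nb_avoiding (Suc j) x y e + (\<Sum>s\<in>e - {y}. nb_avoiding j x s e)"
    if "e \<in> E" "y \<in> e" for e y
    unfolding nb_walks_Suc nb_avoiding.simps
    using that finE by (subst sum.remove[of _ e]) auto
  have "(\<Sum>y\<in>V. nb_walks (Suc j) x y * adjacency E y z) = (\<Sum>e\<in>?S. \<Sum>y\<in>e - {z}. nb_walks (Suc j) x y)"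
    by (rule sum_adjacency[OF z])
  also have "\<dots> = (\<Sum>e\<in>?S. (\<Sum>y\<in>e - {z}. nb_avoiding (Suc j) x y e)
      + (\<Sum>y\<in>e - {z}. \<Sum>s\<in>e - {y}. nb_avoiding j x s e))"
    unfolding sum.distrib[symmetric] by (intro sum.cong refl split) auto
  also have "\<dots> = (\<Sum>e\<in>?S. (\<Sum>y\<in>e - {z}. nb_avoiding (Suc j) x y e)
      + ((u - 2) * (\<Sum>s\<in>e - {z}. nb_avoiding j x s e) + (u - 1) * nb_avoiding j x z e))"
    by (intro sum.cong refl arg_cong2[of _ _ _ _ "(+)"] sum_minus_point_twice) auto
  also have "\<dots> = nb_walks (Suc (Suc j)) x z + ((u - 2) * nb_walks (Suc j) x z
       + (u - 1) * (\<Sum>e\<in>?S. nb_avoiding j x z e))"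
    by (simp add: sum.distrib sum_distrib_left nb_walks_Suc del: nb_avoiding.simps)
  finally show ?thesis
    unfolding sum_nb_avoiding[OF z] by simp
qed

abbreviation "k \<equiv> real r * (real u - 1)"
abbreviation "q \<equiv> (real r - 1) * (real u - 1)"

text \<open>Solved for the longest walks, the step relation becomes the recurrence of
  \<open>F_poly_Suc\<close> with multiplication by \<open>x\<close> replaced by that with
  \<open>A\<close>.\<close>

lemma nb_walks_rec:
  assumes "z \<in> V" and i: "i \<ge> 1"
  shows "real (nb_walks (Suc i) x z) = (\<Sum>y\<in>V. real (nb_walks i x y) * real (adjacency E y z))
     - (real u - 2) * real (nb_walks i x z) - (if i = 1 then k else q) * real (nb_walks (i - 1) x z)"
proof -
  obtain j where j: "i = Suc j" using i by (cases i) auto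
  have "(\<Sum>y\<in>V. real (nb_walks i x y) * real (adjacency E y z))
      = real (\<Sum>y\<in>V. nb_walks i x y * adjacency E y z)"
    by simp
  also have "\<dots> = real (nb_walks (Suc i) x z) + (real u - 2) * real (nb_walks i x z)
      + (real u - 1) * (real (if j = 0 then r else r - 1) * real (nb_walks j x z))"
    unfolding j nb_walks_step[OF assms(1)] using u2 by (simp only: of_nat_add of_nat_mult of_nat_diff) simp
  also have "real (if j = 0 then r else r - 1) = (if i = 1 then real r else real r - 1)"
    using r2 j by (simp add: of_nat_diff)
  finally show ?thesis by (simp add: j)
qed

lemma degree_adjacency:
  assumes "z \<in> V"
  shows "(\<Sum>y\<in>V. real (adjacency E y z)) = k"
proof -
  have "(\<Sum>y\<in>V. adjacency E y z) = (\<Sum>e\<in>{e \<in> E. z \<in> e}. u - 1)"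
    using sum_adjacency[OF assms, of "\<lambda>_. 1"] fin_edge card_edge by simp
  also have "\<dots> = r * (u - 1)" using card_edges_at[OF assms] by simp
  finally show ?thesis using u2 by (simp add: of_nat_diff flip: of_nat_sum)
qed

lemma adjacency_commute: "adjacency E x y = adjacency E y x"
  by (simp add: adjacency_def insert_commute)

text \<open>A polynomial in \<open>A\<close> commutes with \<open>A\<close>; the induction carries
  this out on entries.\<close>

lemma nb_walks_commute:
  assumes "x \<in> V" "z \<in> V"
  shows "(\<Sum>y\<in>V. real (nb_walks i x y) * real (adjacency E y z))
    = (\<Sum>y\<in>V. real (adjacency E x y) * real (nb_walks i y z))"
  using assms
proof (induct i arbitrary: x z rule: less_induct)
  case (less i)
  let ?A = "\<lambda>x y. real (adjacency E x y)" and ?N = "\<lambda>i x y. real (nb_walks i x y)"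
  consider "i = 0" | "i = 1" | j where "i = Suc (Suc j)"
    by (metis One_nat_def old.nat.exhaust)
  then show ?case
  proof cases
    case 1
    then show ?thesis
      using finV less(2,3)
      by (simp add: if_distrib[of "\<lambda>a. a * _"] if_distrib[of "\<lambda>a. _ * a"] if_distrib[of real] cong: if_cong)
  next
    case 2
    then show ?thesis
      using less(2,3) nb_walks_1 by (intro sum.cong) auto
  next
    case (3 j)
    let ?c = "if Suc j = 1 then k else q"
    have "(\<Sum>y\<in>V. ?N i x y * ?A y z) = (\<Sum>y\<in>V. (\<Sum>w\<in>V. ?N (Suc j) x w * ?A w y) * ?A y z)
        - (real u - 2) * (\<Sum>y\<in>V. ?N (Suc j) x y * ?A y z) - ?c * (\<Sum>y\<in>V. ?N j x y * ?A y z)"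
      unfolding 3 sum_distrib_left sum_subtractf[symmetric]
      by (intro sum.cong refl) (simp add: nb_walks_rec algebra_simps)
    also have "(\<Sum>y\<in>V. (\<Sum>w\<in>V. ?N (Suc j) x w * ?A w y) * ?A y z)
        = (\<Sum>y\<in>V. (\<Sum>w\<in>V. ?A x w * ?N (Suc j) w y) * ?A y z)"
      using less(1)[of "Suc j"] less(2) 3 by (intro sum.cong refl) simp
    also have "\<dots> = (\<Sum>w\<in>V. ?A x w * (\<Sum>y\<in>V. ?N (Suc j) w y * ?A y z))"
      unfolding sum_distrib_left sum_distrib_right by (subst sum.swap) (simp add: mult.assoc)
    also have "(\<Sum>y\<in>V. ?N (Suc j) x y * ?A y z) = (\<Sum>y\<in>V. ?A x y * ?N (Suc j) y z)"
      using less 3 by simp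
    also have "(\<Sum>y\<in>V. ?N j x y * ?A y z) = (\<Sum>y\<in>V. ?A x y * ?N j y z)"
      using less 3 by simp
    also have "(\<Sum>w\<in>V. ?A x w * (\<Sum>y\<in>V. ?N (Suc j) w y * ?A y z))
        - (real u - 2) * (\<Sum>y\<in>V. ?A x y * ?N (Suc j) y z) - ?c * (\<Sum>y\<in>V. ?A x y * ?N j y z)
      = (\<Sum>y\<in>V. ?A x y * ?N i y z)"
      unfolding 3 sum_distrib_left[of _ _ V] sum_subtractf[symmetric]
      using less(3) by (intro sum.cong refl) (simp add: nb_walks_rec algebra_simps sum_distrib_left)
    finally show ?thesis .
  qed
qed

text \<open>Instead of reversing walks, the proof transposes the recurrence, using that its factors
  commute.\<close>

lemma nb_walks_sym:
  assumes "x \<in> V" "y \<in> V"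
  shows "nb_walks i x y = nb_walks i y x"
  using assms
proof (induct i arbitrary: x y rule: less_induct)
  case (less i)
  consider "i = 0" | "i = 1" | j where "i = Suc (Suc j)"
    by (metis One_nat_def old.nat.exhaust)
  then show ?case
  proof cases
    case 2
    then show ?thesis using less(2,3) nb_walks_1 adjacency_commute by metis
  next
    case (3 j)
    have "(\<Sum>w\<in>V. real (nb_walks (Suc j) x w) * real (adjacency E w y))
        = (\<Sum>w\<in>V. real (adjacency E y w) * real (nb_walks (Suc j) w x))"
    proof (intro sum.cong refl)
      fix w assume "w \<in> V"
      then have "nb_walks (Suc j) x w = nb_walks (Suc j) w x"
        using less(1)[of "Suc j" x w] less(2) 3 by simp
      then show "real (nb_walks (Suc j) x w) * real (adjacency E w y)
          = real (adjacency E y w) * real (nb_walks (Suc j) w x)"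
        using adjacency_commute[of w y] by simp
    qed
    then have "real (nb_walks i x y) = real (nb_walks i y x)"
      unfolding 3 using less(2,3) less(1)[of "Suc j" x y] less(1)[of j x y] 3 nb_walks_commute[of y x "Suc j"]
      by (simp add: nb_walks_rec)
    then show ?thesis by simp
  qed auto
qed

text \<open>The all-ones vector is an eigenvector of \<open>A\<close> for \<open>k\<close>, hence of
  \<open>F_i(A)\<close> for \<open>F_i(k)\<close>.\<close>

lemma sum_nb_walks:
  assumes "x \<in> V"
  shows "(\<Sum>y\<in>V. real (nb_walks i x y)) = poly (F_poly r u i) k"
  using assms
proof (induct i arbitrary: x rule: less_induct)
  case (less i)
  let ?A = "\<lambda>x y. real (adjacency E x y)" and ?N = "\<lambda>i x y. real (nb_walks i x y)"
  consider "i = 0" | "i = 1" | j where "i = Suc (Suc j)"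
    by (metis One_nat_def old.nat.exhaust)
  then show ?case
  proof cases
    case 1
    then show ?thesis using finV less(2) by (simp add: if_distrib[of real] cong: if_cong)
  next
    case 2
    have "(\<Sum>y\<in>V. ?N 1 x y) = (\<Sum>y\<in>V. ?A y x)"
      using less(2) by (intro sum.cong refl) (simp add: nb_walks_1 adjacency_commute del: One_nat_def)
    then show ?thesis using 2 degree_adjacency[OF less(2)] by simp
  next
    case (3 j)
    have "(\<Sum>y\<in>V. \<Sum>w\<in>V. ?N (Suc j) x w * ?A w y) = (\<Sum>w\<in>V. ?N (Suc j) x w * (\<Sum>y\<in>V. ?A y w))"
      unfolding sum_distrib_left by (subst sum.swap) (simp add: adjacency_commute)
    also have "\<dots> = k * (\<Sum>w\<in>V. ?N (Suc j) x w)"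
      unfolding sum_distrib_left[of k] by (intro sum.cong refl) (simp add: degree_adjacency)
    finally have s: "(\<Sum>y\<in>V. \<Sum>w\<in>V. ?N (Suc j) x w * ?A w y) = k * (\<Sum>w\<in>V. ?N (Suc j) x w)" .
    have "(\<Sum>y\<in>V. ?N i x y) = (\<Sum>y\<in>V. \<Sum>w\<in>V. ?N (Suc j) x w * ?A w y)
      - (real u - 2) * (\<Sum>y\<in>V. ?N (Suc j) x y) - (if Suc j = 1 then k else q) * (\<Sum>y\<in>V. ?N j x y)"
      unfolding 3 sum_distrib_left[of _ _ V] sum_subtractf[symmetric]
      by (intro sum.cong refl) (simp add: nb_walks_rec)
    moreover have "(\<Sum>y\<in>V. ?N (Suc j) x y) = poly (F_poly r u (Suc j)) k"
      "(\<Sum>y\<in>V. ?N j x y) = poly (F_poly r u j) k"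
      using less(1)[of "Suc j" x] less(1)[of j x] less(2) 3 by auto
    ultimately show ?thesis
      unfolding s using poly_F_Suc[OF r2 u2 refl, of "Suc j" k] unfolding 3
      by (simp add: left_diff_distrib del: F_poly.simps)
  qed
qed

end

section \<open>Distances in the point multigraph\<close>

context wf_digraph
begin

lemma graph_distance_eq_iff:
  "graph_distance G x y = ereal (real i) \<longleftrightarrow>
     (\<exists>p. awalk x p y \<and> length p = i) \<and> (\<forall>p. awalk x p y \<longrightarrow> i \<le> length p)"
proof -
  have cost: "awalk_cost (\<lambda>_. 1) p = real (length p)" for p
    by (induct p) (simp_all add: awalk_cost_def)
  have dist: "graph_distance G x y = (INF p\<in>{p. awalk x p y}. ereal (real (length p)))"
    by (simp add: graph_distance_def \<mu>_def cost)
  have min: "graph_distance G x y = ereal (real i)"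
    if "awalk x p y" "length p = i" "\<forall>p. awalk x p y \<longrightarrow> i \<le> length p" for p i
    unfolding dist
  proof (rule INF_eqI)
    show "z \<le> ereal (real i)" if "\<And>p. p \<in> {p. awalk x p y} \<Longrightarrow> z \<le> ereal (real (length p))" for z
      using that[of p] \<open>awalk x p y\<close> \<open>length p = i\<close> by simp
  qed (use that(3) in simp)
  show ?thesis
  proof
    assume d: "graph_distance G x y = ereal (real i)"
    then have "x \<rightarrow>\<^sup>* y"
      using \<mu>_reach_conv[of "\<lambda>_. 1" x y] by (simp add: graph_distance_def)
    then have "\<exists>m p. awalk x p y \<and> length p = m"
      using reachable_awalk by blast
    define m where "m = (LEAST m. \<exists>p. awalk x p y \<and> length p = m)"
    obtain p where p: "awalk x p y" "length p = m"
      using LeastI_ex[OF \<open>\<exists>m p. awalk x p y \<and> length p = m\<close>] unfolding m_def by blast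
    have le: "\<forall>p. awalk x p y \<longrightarrow> m \<le> length p"
      unfolding m_def by (auto intro: Least_le)
    have "i = m" using min[OF p le] d by simp
    then show "(\<exists>p. awalk x p y \<and> length p = i) \<and> (\<forall>p. awalk x p y \<longrightarrow> i \<le> length p)"
      using p le by blast
  qed (use min in blast)
qed

lemma graph_distance_cases:
  obtains i where "graph_distance G x y = ereal (real i)"
  | "graph_distance G x y = \<infinity>" "\<not> x \<rightarrow>\<^sup>* y"
proof (cases "x \<rightarrow>\<^sup>* y")
  case True
  then have ex: "\<exists>m p. awalk x p y \<and> length p = m"
    using reachable_awalk by blast
  define m where "m = (LEAST m. \<exists>p. awalk x p y \<and> length p = m)"
  have "\<exists>p. awalk x p y \<and> length p = m"
    using LeastI_ex[OF ex] unfolding m_def .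
  moreover have "\<forall>p. awalk x p y \<longrightarrow> m \<le> length p"
    unfolding m_def by (auto intro: Least_le)
  ultimately show ?thesis using that(1) graph_distance_eq_iff by blast
next
  case False
  then show ?thesis
    using that(2) shortest_path_inf by (simp add: graph_distance_def)
qed

text \<open>Cutting out a cycle would shorten the walk, so shortest paths can be counted as walks,
  that is, by powers of \<open>A\<close>.\<close>

lemma shortest_paths_eq:
  assumes "graph_distance G x y = ereal (real i)"
  shows "shortest_paths G x y = {p. awalk x p y \<and> length p = i}"
proof -
  have "distinct (awalk_verts x p)" if p: "awalk x p y" "length p = i" for p
  proof (rule ccontr)
    assume "\<not> distinct (awalk_verts x p)"
    then obtain q t s w where "p = q @ t @ s" "t \<noteq> []" "awalk x q w" "awalk w t w" "awalk w s y"
      using awalk_not_distinct_decomp[OF p(1)] by blast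
    then have "awalk x (q @ s) y" "length (q @ s) < i"
      using p(2) awalk_appendI by auto
    moreover have "i \<le> length (q @ s)"
      using assms calculation(1) graph_distance_eq_iff by blast
    ultimately show False by simp
  qed
  then show ?thesis
    unfolding shortest_paths_def assms by (auto simp: apath_def)
qed

end

context regular_uniform_hypergraph
begin

lemma edge_mem: "e \<in> E \<Longrightarrow> x \<in> e \<Longrightarrow> x \<in> V"
  using edge_sub by blast

abbreviation "G \<equiv> point_multigraph V E"

lemma arcs_G: "arcs G = {(x, e, y) | x e y. e \<in> E \<and> x \<in> e \<and> y \<in> e \<and> x \<noteq> y}"
  and verts_G [simp]: "verts G = V" and tail_G [simp]: "tail G (x, e, y) = x"
  and head_G [simp]: "head G (x, e, y) = y"
  by (simp_all add: point_multigraph_def)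

sublocale G: fin_digraph G
proof
  have "arcs G \<subseteq> V \<times> E \<times> V" using edge_sub by (auto simp: arcs_G)
  then show "finite (arcs G)" by (rule finite_subset) (simp add: finV finE)
qed (use finV in \<open>auto simp: arcs_G intro: edge_mem\<close>)

section \<open>Comparing all walks with nonbacktracking walks\<close>

lemma sum_arcs_at:
  "(\<Sum>a\<in>{a \<in> arcs G. tail G a = y}. h (head G a)) = (\<Sum>z\<in>V. adjacency E y z * (h z :: nat))"
proof -
  let ?S = "{a \<in> arcs G. tail G a = y}"
  have "(\<Sum>a\<in>?S. h (head G a)) = (\<Sum>z\<in>V. \<Sum>a\<in>{a \<in> ?S. head G a = z}. h (head G a))"
    by (rule sum.group[symmetric, OF _ finV]) (simp, auto simp: arcs_G intro: edge_mem)
  also have "\<dots> = (\<Sum>z\<in>V. adjacency E y z * h z)"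
  proof (intro sum.cong refl)
    fix z
    have "{a \<in> ?S. head G a = z} = (if y = z then {} else (\<lambda>e. (y, e, z)) ` {e \<in> E. {y, z} \<subseteq> e})"
      by (auto simp: arcs_G)
    then have "card {a \<in> ?S. head G a = z} = adjacency E y z"
      by (simp add: adjacency_def card_image inj_on_def)
    then show "(\<Sum>a\<in>{a \<in> ?S. head G a = z}. h (head G a)) = adjacency E y z * h z"
      by simp
  qed
  finally show ?thesis .
qed

text \<open>The entries of the powers of \<open>A\<close>. The recursion splits off the first step,
  as for arc lists, whereas that of \<open>nb_walks\<close> splits off the last.\<close>

primrec walks :: "nat \<Rightarrow> 'v \<Rightarrow> 'v \<Rightarrow> nat" where
  "walks 0 x y = (if x = y then 1 else 0)"
| "walks (Suc i) x y = (\<Sum>z\<in>V. adjacency E x z * walks i z y)"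

lemma card_awalks:
  assumes "y \<in> V"
  shows "x \<in> V \<Longrightarrow> finite {p. G.awalk x p y \<and> length p = i} \<and>
    card {p. G.awalk x p y \<and> length p = i} = walks i x y"
proof (induct i arbitrary: x)
  case 0
  have "{p. G.awalk x p y \<and> length p = 0} = (if x = y then {[]} else {})"
    using 0 by (auto simp: G.awalk_Nil_iff)
  then show ?case by simp
next
  case (Suc i)
  let ?S = "{a \<in> arcs G. tail G a = x}"
  let ?W = "\<lambda>a. Cons a ` {p. G.awalk (head G a) p y \<and> length p = i}"
  have W: "finite (?W a)" "card (?W a) = walks i (head G a) y" if "a \<in> ?S" for a
    using Suc(1)[of "head G a"] G.head_in_verts[of a] that by (auto simp: card_image)
  have eq: "{p. G.awalk x p y \<and> length p = Suc i} = (\<Union>a\<in>?S. ?W a)"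
    by (auto simp: length_Suc_conv G.awalk_Cons_iff)
  have fS: "finite ?S" by simp
  have "card (\<Union>a\<in>?S. ?W a) = (\<Sum>a\<in>?S. card (?W a))"
    by (rule card_UN_disjoint[OF fS]) (use W in auto)
  also have "\<dots> = (\<Sum>a\<in>?S. walks i (head G a) y)"
    by (rule sum.cong[OF refl W(2)])
  also have "\<dots> = walks (Suc i) x y"
    using sum_arcs_at[of "\<lambda>z. walks i z y" x] by simp
  finally show ?case unfolding eq using fS W(1) by auto
qed

text \<open>Moves the step of \<open>nb_walks_step\<close> to the front of the walk, to match
  \<open>walks\<close>.\<close>

lemma adjacency_nb_walks:
  assumes "x \<in> V" "y \<in> V"
  shows "(\<Sum>z\<in>V. adjacency E x z * nb_walks (Suc i) z y) =
     nb_walks (Suc (Suc i)) x y + (u - 2) * nb_walks (Suc i) x y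
       + (u - 1) * ((if i = 0 then r else r - 1) * nb_walks i x y)"
proof -
  have "(\<Sum>z\<in>V. adjacency E x z * nb_walks (Suc i) z y)
      = (\<Sum>z\<in>V. nb_walks (Suc i) x z * adjacency E z y)"
    using nb_walks_commute[OF assms, of "Suc i"]
    by (simp flip: of_nat_mult of_nat_sum)
  then show ?thesis using nb_walks_step[OF assms(2)] by simp
qed

lemma adjacency_nb_walks_0:
  assumes "x \<in> V" "y \<in> V"
  shows "(\<Sum>z\<in>V. adjacency E x z * nb_walks 0 z y) = nb_walks 1 x y"
  unfolding nb_walks_1[OF assms] using finV assms
  by (simp add: if_distrib[of "\<lambda>a. _ * a"] cong: if_cong)

lemma nb_walks_le_walks:
  "x \<in> V \<Longrightarrow> y \<in> V \<Longrightarrow> nb_walks i x y \<le> walks i x y"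
proof (induct i arbitrary: x)
  case (Suc i)
  have "nb_walks (Suc i) x y \<le> (\<Sum>z\<in>V. adjacency E x z * nb_walks i z y)"
    using adjacency_nb_walks_0[OF Suc(2,3)] adjacency_nb_walks[OF Suc(2,3)]
    by (cases i) (simp_all del: nb_walks_0)
  also have "\<dots> \<le> walks (Suc i) x y"
    using Suc by (auto intro!: sum_mono)
  finally show ?case .
qed auto

text \<open>The \<open>i\<close>th power of the adjacency matrix is \<open>F_poly r u i\<close> plus a combination of lower
  \<open>F_poly r u j\<close>, all evaluated at that matrix.\<close>

lemma walks_le_nb_walks:
  "\<exists>C. \<forall>x\<in>V. \<forall>y\<in>V. walks i x y \<le> nb_walks i x y + C * (\<Sum>j<i. nb_walks j x y)"
proof (induct i)
  case (Suc i)
  define K where "K = (u - 2) + (u - 1) * r"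
  obtain C where C: "\<And>x y. x \<in> V \<Longrightarrow> y \<in> V \<Longrightarrow>
      walks i x y \<le> nb_walks i x y + C * (\<Sum>j<i. nb_walks j x y)"
    using Suc by blast
  \<comment> \<open>\<open>K\<close> bounds the lower terms of one multiplication by
    \<open>A\<close>. The leading term contributes \<open>K\<close> and each of the \<open>i\<close>
    lower ones, weighted by \<open>C\<close>, at most \<open>1 + K\<close>.\<close>
  have "walks (Suc i) x y \<le> nb_walks (Suc i) x y + (K + C * i * (1 + K)) * (\<Sum>j<Suc i. nb_walks j x y)"
    if V: "x \<in> V" "y \<in> V" for x y
  proof -
    let ?S = "\<Sum>j<Suc i. nb_walks j x y"
    let ?M = "\<lambda>j. \<Sum>z\<in>V. adjacency E x z * nb_walks j z y"
    have M: "?M j \<le> nb_walks (Suc j) x y + K * ?S" if "j \<le> i" for j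
    proof (cases j)
      case 0
      then show ?thesis using adjacency_nb_walks_0[OF V] by (simp del: nb_walks_0)
    next
      case (Suc l)
      have "nb_walks j x y \<le> ?S" "nb_walks l x y \<le> ?S"
        using that Suc by (auto intro!: member_le_sum simp del: sum.lessThan_Suc)
      then have "(u - 2) * nb_walks j x y \<le> (u - 2) * ?S"
        "(u - 1) * ((if l = 0 then r else r - 1) * nb_walks l x y) \<le> (u - 1) * (r * ?S)"
        by (auto intro!: mult_mono)
      then show ?thesis
        unfolding Suc adjacency_nb_walks[OF V] K_def add_mult_distrib mult.assoc by linarith
    qed
    have "walks (Suc i) x y \<le> (\<Sum>z\<in>V. adjacency E x z * (nb_walks i z y + C * (\<Sum>j<i. nb_walks j z y)))"
      using C V by (auto intro!: sum_mono)
    also have "\<dots> = ?M i + C * (\<Sum>j<i. ?M j)"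
      unfolding sum.swap[of _ V] by (simp add: sum.distrib sum_distrib_left add_mult_distrib2 mult_ac)
    also have "\<dots> \<le> (nb_walks (Suc i) x y + K * ?S) + C * (\<Sum>j<i. (1 + K) * ?S)"
    proof (intro add_mono mult_left_mono sum_mono M)
      fix j assume j: "j \<in> {..<i}"
      then have "nb_walks (Suc j) x y \<le> ?S"
        by (auto intro!: member_le_sum simp del: sum.lessThan_Suc)
      then show "?M j \<le> (1 + K) * ?S" using M[of j] j by simp
    qed auto
    finally show ?thesis by (simp add: algebra_simps)
  qed
  then show ?case by blast
qed simp

text \<open>The two bounds coincide here. Thus distances and numbers of shortest paths can be read
  off from \<open>nb_walks\<close>.\<close>

lemma walks_eq_nb_walks:
  assumes "x \<in> V" "y \<in> V" "\<And>j. j < i \<Longrightarrow> nb_walks j x y = 0"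
  shows "walks i x y = nb_walks i x y"
proof -
  obtain C where "walks i x y \<le> nb_walks i x y + C * (\<Sum>j<i. nb_walks j x y)"
    using walks_le_nb_walks assms(1,2) by blast
  then show ?thesis
    using nb_walks_le_walks[OF assms(1,2), of i] assms(3) by simp
qed

lemma distance_iff_nb_walks:
  assumes V: "x \<in> V" "y \<in> V"
  shows "graph_distance G x y = ereal (real i) \<longleftrightarrow> nb_walks i x y \<noteq> 0 \<and> (\<forall>j<i. nb_walks j x y = 0)"
proof -
  have ex: "(\<exists>p. G.awalk x p y \<and> length p = j) \<longleftrightarrow> walks j x y \<noteq> 0" for j
    using card_awalks[OF V(2,1), of j] by (metis (mono_tags, lifting) Collect_empty_eq card_0_eq)
  have "graph_distance G x y = ereal (real i) \<longleftrightarrow> walks i x y \<noteq> 0 \<and> (\<forall>j<i. walks j x y = 0)"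
    unfolding G.graph_distance_eq_iff using ex by (metis not_less)
  also have "(\<forall>j<i. walks j x y = 0) \<longleftrightarrow> (\<forall>j<i. nb_walks j x y = 0)"
  proof (intro iffI allI impI)
    fix j assume "\<forall>j<i. walks j x y = 0" "j < i"
    then show "nb_walks j x y = 0" using nb_walks_le_walks[OF V, of j] by simp
  next
    fix j assume "\<forall>j<i. nb_walks j x y = 0" "j < i"
    then show "walks j x y = 0" using walks_eq_nb_walks[OF V, of j] by simp
  qed
  finally show ?thesis using walks_eq_nb_walks[OF V, of i] by metis
qed

lemma card_shortest_paths:
  assumes V: "x \<in> V" "y \<in> V" and d: "graph_distance G x y = ereal (real i)"
  shows "card (shortest_paths G x y) = nb_walks i x y"
  using d card_awalks[OF V(2,1), of i] walks_eq_nb_walks[OF V, of i]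
  unfolding G.shortest_paths_eq[OF d] distance_iff_nb_walks[OF V] by simp

section \<open>Intersection numbers, diameter and connectedness\<close>

lemma num_edges_to_distance_eq:
  "num_edges_to_distance G x y j
     = (\<Sum>z\<in>V. if graph_distance G x z = ereal (real j) then adjacency E y z else 0)"
proof -
  let ?P = "\<lambda>z. graph_distance G x z = ereal (real j)" and ?S = "{a \<in> arcs G. tail G a = y}"
  have "num_edges_to_distance G x y j = (\<Sum>a\<in>{a \<in> ?S. ?P (head G a)}. 1)"
    unfolding num_edges_to_distance_def by (auto intro!: arg_cong[of _ _ card])
  also have "\<dots> = (\<Sum>a\<in>?S. if ?P (head G a) then 1 else 0)"
    by (rule sum.mono_neutral_cong_left) auto
  also have "\<dots> = (\<Sum>z\<in>V. adjacency E y z * (if ?P z then 1 else 0))"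
    by (rule sum_arcs_at)
  also have "\<dots> = (\<Sum>z\<in>V. if ?P z then adjacency E y z else 0)"
    by (rule sum.cong[OF refl]) simp
  finally show ?thesis .
qed

lemma distance_step:
  assumes "graph_distance G x z = ereal (real i)" "graph_distance G x y = ereal (real j)"
    and "adjacency E z y \<noteq> 0"
  shows "j \<le> Suc i"
proof -
  obtain p where p: "G.awalk x p z" "length p = i"
    using assms(1) unfolding G.graph_distance_eq_iff by blast
  have zy: "z \<noteq> y" "{e \<in> E. {z, y} \<subseteq> e} \<noteq> {}"
    using assms(3) unfolding adjacency_def by (metis card.empty)+
  then obtain e where "(z, e, y) \<in> arcs G" by (auto simp: arcs_G)
  then have "G.awalk z [(z, e, y)] y"
    using G.arc_implies_awalk by fastforce
  then have "G.awalk x (p @ [(z, e, y)]) y"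
    using p(1) by (rule G.awalk_appendI[rotated])
  then show ?thesis
    using assms(2) p(2) unfolding G.graph_distance_eq_iff by (metis length_append_singleton)
qed

lemma diameter_imp_distance:
  assumes "graph_diameter G = ereal (real d)" "x \<in> V" "y \<in> V"
  obtains i where "i \<le> d" "graph_distance G x y = ereal (real i)"
proof -
  have "graph_distance G x y \<le> ereal (real d)"
    unfolding assms(1)[symmetric] graph_diameter_def using assms(2,3) by (intro SUP_upper2[of "(x, y)"]) auto
  then show ?thesis
    by (cases rule: G.graph_distance_cases[of x y]) (use that in auto)
qed

lemma distances_imp_connected_diameter:
  assumes "\<And>x y. x \<in> V \<Longrightarrow> y \<in> V \<Longrightarrow> \<exists>i\<le>d. graph_distance G x y = ereal (real i)"
    and "x0 \<in> V" "y0 \<in> V" "graph_distance G x0 y0 = ereal (real d)"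
  shows "Digraph_Component.connected G" "graph_diameter G = ereal (real d)"
proof -
  have "x \<rightarrow>\<^sup>*\<^bsub>G\<^esub> y" if V: "x \<in> V" "y \<in> V" for x y
    using assms(1)[OF that] G.graph_distance_cases[of x y]
    by (metis G.graph_distance_eq_iff G.reachable_awalk)
  then show "Digraph_Component.connected G"
    using ne G.reachable_mk_symmetricI
    by (auto simp: Digraph_Component.connected_def strongly_connected_def)
  show "graph_diameter G = ereal (real d)"
    unfolding graph_diameter_def
  proof (rule antisym)
    show "(SUP (x, y)\<in>verts G \<times> verts G. graph_distance G x y) \<le> ereal (real d)"
      using assms(1) by (intro SUP_least) fastforce
    show "ereal (real d) \<le> (SUP (x, y)\<in>verts G \<times> verts G. graph_distance G x y)"
      using assms(2-4) by (intro SUP_upper2[of "(x0, y0)"]) auto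
  qed
qed

end

section \<open>The spectrum of the adjacency matrix\<close>

lemma proots_linear_factors: "proots (\<Prod>a\<leftarrow>as. [:- a, 1:]) = mset (as :: real list)"
proof (induct as)
  case (Cons a as)
  have "(\<Prod>a\<leftarrow>as. [:- a, 1:]) \<noteq> 0" by (auto simp: prod_list_zero_iff)
  then show ?case using Cons by (simp add: proots_mult del: mult_pCons_left)
qed simp

text \<open>Only one copy of the maximum \<open>k\<close> is removed; if \<open>k\<close> is a
  multiple eigenvalue, \<open>t\<close> is \<open>k\<close> again.\<close>

lemma second_largest_in_list:
  fixes k :: "'a :: linorder"
  assumes "k \<in> set es" "\<And>e. e \<in> set es \<Longrightarrow> e \<le> k" "length es \<ge> 2"
  defines "t \<equiv> rev (sort es) ! 1"
  shows "t \<in> set (remove1 k es)" "e \<in> set (remove1 k es) \<Longrightarrow> e \<le> t"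
proof -
  let ?l = "sort (remove1 k es)"
  have "mset es = mset (k # remove1 k es)" using assms(1) by simp
  then have "sort es = insort k ?l"
    by (metis sorted_list_of_multiset_mset sort_key_simps(2))
  also have "\<dots> = ?l @ [k]"
    using assms(2) by (intro sorted_insort_is_snoc) (auto dest: notin_set_remove1)
  finally have s: "sort es = ?l @ [k]" .
  have "?l \<noteq> []" using assms(1,3) by (auto simp: length_remove1 dest: arg_cong[of _ _ length])
  then obtain l' z where l: "?l = l' @ [z]" by (metis rev_exhaust)
  then have t: "t = z" by (simp add: t_def s)
  have "set (remove1 k es) = set ?l" by simp
  also have "\<dots> = insert z (set l')" unfolding l by simp
  finally have set: "set (remove1 k es) = insert z (set l')" .
  then show "t \<in> set (remove1 k es)" by (simp add: t)
  have "sorted (l' @ [z])" unfolding l[symmetric] by simp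
  then show "e \<in> set (remove1 k es) \<Longrightarrow> e \<le> t"
    unfolding set t by (auto simp: sorted_append)
qed

section \<open>The eigenvalue \<open>k\<close> and the trace formula\<close>

context regular_uniform_hypergraph
begin

abbreviation "n \<equiv> card V"
abbreviation "A \<equiv> adjacency_matrix V E"
abbreviation "vertex \<equiv> from_nat_into V"

lemma n_ge_2: "n \<ge> 2"
proof -
  obtain x where "x \<in> V" using ne by blast
  then have "{e \<in> E. x \<in> e} \<noteq> {}" using card_edges_at[of x] r2 by fastforce
  then obtain e where "e \<in> E" by blast
  then show ?thesis
    using card_edge[of e] card_mono[OF finV edge_sub[of e]] u2 by simp
qed

lemma vertex_in [simp]: "vertex i \<in> V"
  using ne by (rule from_nat_into)

lemma sum_vertex: "(\<Sum>i<n. h (vertex i)) = (\<Sum>x\<in>V. h x)"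
  using bij_betw_from_nat_into_finite[OF finV] by (rule sum.reindex_bij_betw)

lemma vertex_eq_iff: "i < n \<Longrightarrow> j < n \<Longrightarrow> vertex i = vertex j \<longleftrightarrow> i = j"
  using bij_betw_imp_inj_on[OF bij_betw_from_nat_into_finite[OF finV]] by (auto simp: inj_on_def)

lemma A_carrier: "A \<in> carrier_mat n n"
  by (simp add: adjacency_matrix_def)

lemma A_entry: "i < n \<Longrightarrow> j < n \<Longrightarrow> A $$ (i, j) = real (adjacency E (vertex i) (vertex j))"
  by (simp add: adjacency_matrix_def)

lemma eigenvalue_degree: "eigenvalue A k"
proof -
  have "A *\<^sub>v vec n (\<lambda>_. 1) = k \<cdot>\<^sub>v vec n (\<lambda>_. 1)"
  proof (rule eq_vecI)
    fix i assume "i < dim_vec (k \<cdot>\<^sub>v vec n (\<lambda>_. 1))"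
    then have i: "i < n" by simp
    have "(A *\<^sub>v vec n (\<lambda>_. 1)) $ i = (\<Sum>j<n. real (adjacency E (vertex j) (vertex i)))"
      using A_carrier i
      by (auto simp: scalar_prod_def A_entry adjacency_commute[of "vertex i"] atLeast0LessThan intro!: sum.cong)
    also have "\<dots> = k"
      unfolding sum_vertex[of "\<lambda>x. real (adjacency E x (vertex i))"] by (simp add: degree_adjacency)
    finally show "(A *\<^sub>v vec n (\<lambda>_. 1)) $ i = (k \<cdot>\<^sub>v vec n (\<lambda>_. 1)) $ i" using i by simp
  qed (use A_carrier in auto)
  moreover have "vec n (\<lambda>_. 1 :: real) \<noteq> 0\<^sub>v n"
  proof
    assume "vec n (\<lambda>_. 1 :: real) = 0\<^sub>v n"
    then have "vec n (\<lambda>_. 1 :: real) $ 0 = 0\<^sub>v n $ 0" by simp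
    then show False using n_ge_2 by simp
  qed
  ultimately show ?thesis
    unfolding eigenvalue_def eigenvector_def using A_carrier by (intro exI[of _ "vec n (\<lambda>_. 1)"]) auto
qed

text \<open>The row sum bound, read off at a coordinate \<open>m\<close> where the eigenvector has
  largest modulus.\<close>

lemma eigenvalue_le_degree:
  assumes "eigenvalue A e"
  shows "e \<le> k"
proof -
  obtain v where v: "v \<in> carrier_vec n" "v \<noteq> 0\<^sub>v n" "A *\<^sub>v v = e \<cdot>\<^sub>v v"
    using assms A_carrier unfolding eigenvalue_def eigenvector_def by auto
  have "0 \<in> {..<n}" using n_ge_2 by simp
  then have "finite ((\<lambda>i. \<bar>v $ i\<bar>) ` {..<n})" "(\<lambda>i. \<bar>v $ i\<bar>) ` {..<n} \<noteq> {}" by blast+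
  from Max_in[OF this] obtain m where m: "m < n" "\<bar>v $ m\<bar> = Max ((\<lambda>i. \<bar>v $ i\<bar>) ` {..<n})" by auto
  have max: "\<bar>v $ i\<bar> \<le> \<bar>v $ m\<bar>" if "i < n" for i
    using that unfolding m(2) by (intro Max_ge) auto
  obtain i where "i < n" "v $ i \<noteq> 0" using v by (metis eq_vecI carrier_vecD index_zero_vec)
  then have pos: "\<bar>v $ m\<bar> > 0" using max[of i] by auto
  have "e * v $ m = (\<Sum>j<n. real (adjacency E (vertex m) (vertex j)) * v $ j)"
  proof -
    have "(A *\<^sub>v v) $ m = (\<Sum>j<n. real (adjacency E (vertex m) (vertex j)) * v $ j)"
      using A_carrier v(1) m(1) by (auto simp: scalar_prod_def A_entry atLeast0LessThan intro!: sum.cong)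
    then show ?thesis unfolding v(3) using m(1) v(1) by simp
  qed
  then have "\<bar>e\<bar> * \<bar>v $ m\<bar> \<le> (\<Sum>j<n. \<bar>real (adjacency E (vertex m) (vertex j)) * v $ j\<bar>)"
    by (metis abs_mult sum_abs)
  also have "\<dots> \<le> (\<Sum>j<n. real (adjacency E (vertex j) (vertex m)) * \<bar>v $ m\<bar>)"
    using max by (intro sum_mono) (auto simp: abs_mult adjacency_commute[of "vertex m"] intro!: mult_left_mono)
  also have "\<dots> = k * \<bar>v $ m\<bar>"
    unfolding sum_distrib_right[symmetric] sum_vertex[of "\<lambda>x. real (adjacency E x (vertex m))"]
    by (simp add: degree_adjacency)
  finally show ?thesis using pos by (simp add: mult_le_cancel_right)
qed

lemma trace_nb_walks:
  assumes split: "char_poly A = (\<Prod>a\<leftarrow>es. [:- a, 1:])" and len: "length es = n"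
  shows "(\<Sum>x\<in>V. \<Sum>y\<in>V. real (nb_walks i x y) * real (nb_walks j x y))
    = (\<Sum>e\<leftarrow>es. poly (F_poly r u i) e * poly (F_poly r u j) e)"
proof -
  obtain P Q where PQ: "triangularizing P Q es n" and tA: "triangular_conj P Q es [:0, 1:] A"
    using triangularizing_exists[OF A_carrier split len] .
  interpret T: triangularizing P Q es n by (rule PQ)
  define M where "M i = mat n n (\<lambda>(a, b). real (nb_walks i (vertex a) (vertex b)))" for i
  have M: "M i \<in> carrier_mat n n" for i by (simp add: M_def)
  have M_entry: "M i $$ (a, b) = real (nb_walks i (vertex a) (vertex b))" if "a < n" "b < n" for i a b
    using that by (simp add: M_def)
  have entry: "(M i * X) $$ (a, b) = (\<Sum>l<n. real (nb_walks i (vertex a) (vertex l)) * X $$ (l, b))"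
    if "a < n" "b < n" "X \<in> carrier_mat n n" for a b X i
    using that M[of i] by (auto simp: scalar_prod_def M_entry atLeast0LessThan intro!: sum.cong)
  have conj: "triangular_conj P Q es (F_poly r u i) (M i)" for i
  proof (induct i rule: less_induct)
    case (less i)
    consider "i = 0" | "i = 1" | j where "i = Suc (Suc j)"
      by (metis One_nat_def old.nat.exhaust)
    then show ?case
    proof cases
      case 1
      have "M 0 = 1\<^sub>m n"
        by (rule eq_matI) (auto simp: M_def vertex_eq_iff)
      then show ?thesis using 1 T.one by simp
    next
      case 2
      have "M 1 = A"
        by (rule eq_matI) (use A_carrier in \<open>auto simp: M_entry A_entry nb_walks_1 M_def simp del: One_nat_def\<close>)
      then show ?thesis using 2 tA by simp
    next
      case (3 j)
      let ?c = "if Suc j = 1 then k else q"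
      \<comment> \<open>Nested two-term combinations, the form that \<open>T.lincomb\<close>
        produces; the scalars 1 are padding.\<close>
      let ?X = "1 \<cdot>\<^sub>m (1 \<cdot>\<^sub>m (M (Suc j) * A) + (- (real u - 2)) \<cdot>\<^sub>m M (Suc j)) + (- ?c) \<cdot>\<^sub>m M j"
      have IH: "triangular_conj P Q es (F_poly r u (Suc j)) (M (Suc j))"
        "triangular_conj P Q es (F_poly r u j) (M j)"
        using less 3 by auto
      have "F_poly r u (Suc (Suc j)) = Polynomial.smult 1 (Polynomial.smult 1 (F_poly r u (Suc j) * [:0, 1:])
          + Polynomial.smult (- (real u - 2)) (F_poly r u (Suc j))) + Polynomial.smult (- ?c) (F_poly r u j)"
        using F_poly_Suc[of "Suc j" r u] by (simp del: F_poly.simps)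
      moreover have "triangular_conj P Q es \<dots> ?X"
        by (intro T.lincomb T.mult IH tA)
      moreover have "M (Suc (Suc j)) = ?X"
      proof (rule eq_matI)
        fix a b assume "a < dim_row ?X" "b < dim_col ?X"
        then have ab: "a < n" "b < n" using M[of j] by auto
        have "(M (Suc j) * A) $$ (a, b)
            = (\<Sum>y\<in>V. real (nb_walks (Suc j) (vertex a) y) * real (adjacency E y (vertex b)))"
          unfolding entry[OF ab A_carrier]
          by (subst sum_vertex[symmetric]) (simp add: A_entry ab)
        then show "M (Suc (Suc j)) $$ (a, b) = ?X $$ (a, b)"
          using ab M A_carrier nb_walks_rec[of "vertex b" "Suc j" "vertex a"]
          by (simp add: M_entry carrier_matD[OF M] carrier_matD[OF A_carrier] left_diff_distrib)
      qed (use M[of j] M[of "Suc (Suc j)"] in auto)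
      ultimately show ?thesis using 3 by simp
    qed
  qed
  have "(\<Sum>a<n. (M i * M j) $$ (a, a)) = (\<Sum>a<n. poly (F_poly r u i * F_poly r u j) (es ! a))"
    by (rule T.trace[OF T.mult[OF conj conj]])
  also have "\<dots> = (\<Sum>e\<leftarrow>es. poly (F_poly r u i) e * poly (F_poly r u j) e)"
    by (simp add: sum_list_sum_nth len atLeast0LessThan)
  \<comment> \<open>Symmetry of \<open>M j\<close> turns the trace of the product into an entrywise
    inner product.\<close>
  also have "(\<Sum>a<n. (M i * M j) $$ (a, a))
      = (\<Sum>a<n. \<Sum>b<n. real (nb_walks i (vertex a) (vertex b)) * real (nb_walks j (vertex a) (vertex b)))"
  proof (rule sum.cong[OF refl])
    fix a assume "a \<in> {..<n}"
    then have a: "a < n" by simp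
    show "(M i * M j) $$ (a, a)
      = (\<Sum>b<n. real (nb_walks i (vertex a) (vertex b)) * real (nb_walks j (vertex a) (vertex b)))"
      unfolding entry[OF a a M]
      by (rule sum.cong[OF refl]) (simp add: M_entry a nb_walks_sym[of "vertex a"])
  qed
  also have "\<dots> = (\<Sum>x\<in>V. \<Sum>y\<in>V. real (nb_walks i x y) * real (nb_walks j x y))"
    unfolding sum_vertex[symmetric] ..
  finally show ?thesis .
qed

text \<open>Here \<open>es\<close> is the spectrum without one copy of \<open>k\<close>. All later
  arguments reach the eigenvalues through these three facts.\<close>

lemma spectrum:
  obtains es where
    "second_eigenvalue V E \<in> set es" "\<And>e. e \<in> set es \<Longrightarrow> e \<le> second_eigenvalue V E"
    "\<And>i j. (\<Sum>x\<in>V. \<Sum>y\<in>V. real (nb_walks i x y) * real (nb_walks j x y))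
      = poly (F_poly r u i) k * poly (F_poly r u j) k
        + (\<Sum>e\<leftarrow>es. poly (F_poly r u i) e * poly (F_poly r u j) e)"
proof -
  obtain es where split: "char_poly A = (\<Prod>a\<leftarrow>es. [:- a, 1:])" and len: "length es = n"
    using char_poly_real_symmetric_mat[OF A_carrier] A_entry adjacency_commute by metis
  have ev: "eigenvalue A e \<longleftrightarrow> e \<in> set es" for e
    unfolding eigenvalue_root_char_poly[OF A_carrier] split poly_prod_list
    by (auto simp: prod_list_zero_iff)
  have t: "second_eigenvalue V E = rev (sort es) ! 1"
    by (simp add: second_eigenvalue_def split proots_linear_factors)
  have k: "k \<in> set es" using ev eigenvalue_degree by blast
  have le: "e \<le> k" if "e \<in> set es" for e using ev eigenvalue_le_degree that by blast
  show ?thesis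
  proof (rule that[of "remove1 k es"])
    show "second_eigenvalue V E \<in> set (remove1 k es)"
      "\<And>e. e \<in> set (remove1 k es) \<Longrightarrow> e \<le> second_eigenvalue V E"
      unfolding t using second_largest_in_list[OF k le] len n_ge_2 by auto
    show "(\<Sum>x\<in>V. \<Sum>y\<in>V. real (nb_walks i x y) * real (nb_walks j x y))
      = poly (F_poly r u i) k * poly (F_poly r u j) k
        + (\<Sum>e\<leftarrow>remove1 k es. poly (F_poly r u i) e * poly (F_poly r u j) e)" for i j
      unfolding trace_nb_walks[OF split len] by (rule sum_list_map_remove1[OF k])
  qed
qed

end

section \<open>The bound on the second eigenvalue\<close>

lemma sum_list_nonpos_eq_0:
  assumes "\<And>e. e \<in> set es \<Longrightarrow> f e \<le> (0 :: real)" "(\<Sum>e\<leftarrow>es. f e) \<ge> 0" "e \<in> set es"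
  shows "f e = 0"
  using assms
proof (induct es)
  case (Cons a es)
  have "(\<Sum>e\<leftarrow>es. f e) \<le> 0" using Cons(2) by (intro sum_list_nonpos) auto
  moreover have "f a \<le> 0" using Cons(2) by simp
  ultimately have "f a = 0" "(\<Sum>e\<leftarrow>es. f e) \<ge> 0" using Cons(3) by auto
  then show ?case using Cons by auto
qed simp

lemma sum_list_sum_swap: "(\<Sum>e\<leftarrow>es. \<Sum>i\<in>I. f e i) = (\<Sum>i\<in>I. \<Sum>e\<leftarrow>es. (f e i :: real))"
  by (induct es) (simp_all add: sum.distrib)

locale hypergraph_spectrum = regular_uniform_hypergraph V E r u
  for V :: "'v set" and E :: "'v set set" and r u :: nat +
  fixes d :: nat and c :: real and es :: "real list"
  assumes size: "size_parameters k q n d c"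
    and second_in: "second_eigenvalue V E \<in> set es"
    and second_max: "\<And>e. e \<in> set es \<Longrightarrow> e \<le> second_eigenvalue V E"
    and trace: "\<And>i j. (\<Sum>x\<in>V. \<Sum>y\<in>V. real (nb_walks i x y) * real (nb_walks j x y))
      = poly (F_poly r u i) k * poly (F_poly r u j) k
        + (\<Sum>e\<leftarrow>es. poly (F_poly r u i) e * poly (F_poly r u j) e)"
begin

lemma d1: "d \<ge> 1" and c1: "c \<ge> 1"
  using size by (auto simp: size_parameters_def)

abbreviation "\<tau> \<equiv> second_eigenvalue V E"

text \<open>Polynomials are kept as coefficient vectors in the basis \<open>F_0, ..., F_d\<close>,
  where the positivity of \<open>h\<close> is visible; \<open>comb_mat\<close> is the value at the
  adjacency matrix.\<close>

definition comb :: "(nat \<Rightarrow> real) \<Rightarrow> real \<Rightarrow> real" where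
  "comb a x = (\<Sum>i\<le>d. a i * poly (F_poly r u i) x)"

definition comb_mat :: "(nat \<Rightarrow> real) \<Rightarrow> 'v \<Rightarrow> 'v \<Rightarrow> real" where
  "comb_mat a x y = (\<Sum>i\<le>d. a i * real (nb_walks i x y))"

lemma trace_comb:
  "(\<Sum>x\<in>V. \<Sum>y\<in>V. comb_mat a x y * comb_mat b x y)
    = comb a k * comb b k + (\<Sum>e\<leftarrow>es. comb a e * comb b e)"
proof -
  let ?F = "\<lambda>i. poly (F_poly r u i)"
  have prod: "(\<Sum>i\<le>d. a i * f i) * (\<Sum>j\<le>d. b j * g j) = (\<Sum>i\<le>d. \<Sum>j\<le>d. a i * b j * (f i * g j))"
    for f g :: "nat \<Rightarrow> real"
    unfolding sum_product by (simp add: mult_ac)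
  have "(\<Sum>x\<in>V. \<Sum>y\<in>V. comb_mat a x y * comb_mat b x y)
      = (\<Sum>i\<le>d. \<Sum>j\<le>d. a i * b j * (\<Sum>x\<in>V. \<Sum>y\<in>V. real (nb_walks i x y) * real (nb_walks j x y)))"
    unfolding comb_mat_def prod
    by (simp only: sum_distrib_left sum.swap[of _ "{..d}" V])
  also have "\<dots> = (\<Sum>i\<le>d. \<Sum>j\<le>d. a i * b j * (?F i k * ?F j k))
      + (\<Sum>i\<le>d. \<Sum>j\<le>d. \<Sum>e\<leftarrow>es. a i * b j * (?F i e * ?F j e))"
    unfolding trace by (simp add: distrib_left sum.distrib sum_list_const_mult)
  also have "(\<Sum>i\<le>d. \<Sum>j\<le>d. \<Sum>e\<leftarrow>es. a i * b j * (?F i e * ?F j e)) = (\<Sum>e\<leftarrow>es. comb a e * comb b e)"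
    unfolding comb_def prod sum_list_sum_swap ..
  also have "(\<Sum>i\<le>d. \<Sum>j\<le>d. a i * b j * (?F i k * ?F j k)) = comb a k * comb b k"
    unfolding comb_def prod ..
  finally show ?thesis .
qed

lemma sum_comb_mat:
  assumes "x \<in> V"
  shows "(\<Sum>y\<in>V. comb_mat a x y) = comb a k"
proof -
  have "(\<Sum>y\<in>V. comb_mat a x y) = (\<Sum>i\<le>d. a i * (\<Sum>y\<in>V. real (nb_walks i x y)))"
    unfolding comb_mat_def sum_distrib_left by (rule sum.swap)
  then show ?thesis by (simp add: sum_nb_walks[OF assms] comb_def)
qed

text \<open>Subtracting the constant matrix removes the part of \<open>p(A)\<close> on the all-ones
  vector, which accounts for the copy of \<open>k\<close> missing from \<open>es\<close>.\<close>

lemma sum_squares_comb_mat: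
  "(\<Sum>x\<in>V. \<Sum>y\<in>V. (comb_mat a x y - comb a k / n)\<^sup>2) = (\<Sum>e\<leftarrow>es. (comb a e)\<^sup>2)"
proof -
  have n: "real n > 0" using n_ge_2 by simp
  let ?m = "comb a k / n"
  have sq: "(z - m)\<^sup>2 = z * z - 2 * m * z + m\<^sup>2" for z m :: real
    by (simp add: power2_eq_square algebra_simps)
  have "(\<Sum>x\<in>V. \<Sum>y\<in>V. (comb_mat a x y - ?m)\<^sup>2)
      = (\<Sum>x\<in>V. \<Sum>y\<in>V. comb_mat a x y * comb_mat a x y) - 2 * ?m * (\<Sum>x\<in>V. \<Sum>y\<in>V. comb_mat a x y)
        + n * (n * ?m\<^sup>2)"
    unfolding sq by (simp only: sum.distrib sum_subtractf sum_distrib_left[symmetric] sum_constant)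
  also have "(\<Sum>x\<in>V. \<Sum>y\<in>V. comb_mat a x y) = n * comb a k"
    by (simp add: sum_comb_mat)
  also have "z - 2 * ?m * (n * comb a k) + n * (n * ?m\<^sup>2) = z - (comb a k)\<^sup>2" for z
    using n by (simp add: field_simps power2_eq_square)
  finally have "(\<Sum>x\<in>V. \<Sum>y\<in>V. (comb_mat a x y - ?m)\<^sup>2)
      = (\<Sum>x\<in>V. \<Sum>y\<in>V. comb_mat a x y * comb_mat a x y) - (comb a k)\<^sup>2" .
  then show ?thesis
    unfolding trace_comb by (simp add: power2_eq_square)
qed

lemma comb_vanishes_iff:
  "(\<forall>e\<in>set es. comb a e = 0) \<longleftrightarrow> (\<forall>x\<in>V. \<forall>y\<in>V. comb_mat a x y = comb a k / n)"
proof -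
  have "(\<forall>e\<in>set es. comb a e = 0) \<longleftrightarrow> (\<Sum>e\<leftarrow>es. (comb a e)\<^sup>2) = 0"
    by (subst sum_list_nonneg_eq_0_iff) auto
  also have "\<dots> \<longleftrightarrow> (\<forall>x\<in>V. (\<Sum>y\<in>V. (comb_mat a x y - comb a k / n)\<^sup>2) = 0)"
    unfolding sum_squares_comb_mat[symmetric]
    by (rule sum_nonneg_eq_0_iff[OF finV]) (simp add: sum_nonneg)
  also have "\<dots> \<longleftrightarrow> (\<forall>x\<in>V. \<forall>y\<in>V. comb_mat a x y = comb a k / n)"
    using finV by (simp add: sum_nonneg_eq_0_iff)
  finally show ?thesis .
qed

definition g :: "nat \<Rightarrow> real" where
  "g i = (if i < d then c else 1)"

lemma split_last: "(\<Sum>i\<le>d. f i) = (\<Sum>i<d. f i) + (f d :: real)"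
  by (simp flip: lessThan_Suc_atMost)

lemma comb_g: "comb g x = poly (quasi_poly r u d c) x"
  by (simp add: comb_def split_last g_def quasi_poly_def poly_sum)

lemma comb_mat_g: "comb_mat g x y = c * real (\<Sum>i<d. nb_walks i x y) + real (nb_walks d x y)"
  by (simp add: comb_mat_def split_last g_def sum_distrib_left)

lemma F_pos: "poly (F_poly r u i) k > 0"
  using poly_F_pos[OF r2 u2 refl refl] .

text \<open>This is the equation defining \<open>(d, c)\<close>, multiplied by
  \<open>c\<close>.\<close>

lemma comb_g_degree: "comb g k = c * n"
proof -
  obtain e where e: "d = Suc e" using d1 by (cases d) auto
  have F: "poly (F_poly r u (Suc i)) k = k * q ^ i" for i
    using poly_F_at_degree[OF r2 u2 refl _ refl, of "Suc i"] by simp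
  have "(\<Sum>i<d. poly (F_poly r u i) k) = 1 + (\<Sum>j<e. k * q ^ j)"
    unfolding e sum.lessThan_Suc_shift F by simp
  then have "comb g k = c * (1 + (\<Sum>j<e. k * q ^ j)) + k * q ^ e"
    unfolding comb_def split_last by (simp add: g_def F[of e, folded e] flip: sum_distrib_left)
  moreover have "real n = 1 + (\<Sum>j<e. k * q ^ j) + k * q ^ e / c"
    using size by (simp add: size_parameters_def e)
  ultimately show ?thesis using c1 by (simp add: field_simps)
qed

lemma sum_F_less_n: "(\<Sum>i<d. poly (F_poly r u i) k) < n"
proof -
  have "c * (\<Sum>i<d. poly (F_poly r u i) k) + poly (F_poly r u d) k = c * n"
    using comb_g_degree unfolding comb_def split_last by (simp add: g_def sum_distrib_left)
  then have "c * (\<Sum>i<d. poly (F_poly r u i) k) < c * n"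
    using F_pos[of d] by simp
  then show ?thesis using c1 by simp
qed

text \<open>Pigeonhole: fewer than \<open>n\<close> nonbacktracking walks of length below
  \<open>d\<close> start at \<open>x\<close>.\<close>

lemma ex_far_pair:
  assumes "x \<in> V"
  obtains y where "y \<in> V" "\<And>i. i < d \<Longrightarrow> nb_walks i x y = 0"
proof -
  have "\<exists>y\<in>V. (\<Sum>i<d. nb_walks i x y) = 0"
  proof (rule ccontr)
    assume no: "\<not> ?thesis"
    have "1 \<le> (\<Sum>i<d. nb_walks i x y)" if "y \<in> V" for y
    proof -
      have "(\<Sum>i<d. nb_walks i x y) \<noteq> 0" using no that by (metis (full_types))
      then show ?thesis by linarith
    qed
    then have "(\<Sum>y\<in>V. 1) \<le> (\<Sum>y\<in>V. \<Sum>i<d. nb_walks i x y)"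
      by (rule sum_mono)
    also have "\<dots> = (\<Sum>i<d. \<Sum>y\<in>V. nb_walks i x y)"
      by (rule sum.swap)
    finally have "n \<le> (\<Sum>i<d. \<Sum>y\<in>V. nb_walks i x y)" by simp
    then have "real n \<le> (\<Sum>i<d. \<Sum>y\<in>V. real (nb_walks i x y))"
      unfolding of_nat_sum[symmetric] of_nat_le_iff .
    then show False
      using sum_F_less_n by (simp add: sum_nb_walks[OF assms])
  qed
  then show ?thesis using that by auto
qed

lemma kernel:
  obtains h \<gamma> where "\<gamma> > 0" "\<And>i. i < d \<Longrightarrow> h i > 0" "h d = 0"
    "\<And>x. (x - lambda_dc r u d c) * comb h x = \<gamma> * comb g x"
proof (rule kernel_at_lambda_dc[OF r2 u2 refl d1, of c])
  fix a :: "nat \<Rightarrow> real" and \<gamma> :: real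
  assume a: "\<gamma> > 0" "\<And>i. i < d \<Longrightarrow> a i > 0"
    "\<And>x. (x - lambda_dc r u d c) * (\<Sum>i<d. a i * poly (F_poly r u i) x) = \<gamma> * poly (quasi_poly r u d c) x"
  have "comb (\<lambda>i. if i < d then a i else 0) x = (\<Sum>i<d. a i * poly (F_poly r u i) x)" for x
    unfolding comb_def split_last by simp
  then show thesis
    by (intro that[of \<gamma> "\<lambda>i. if i < d then a i else 0"]) (use a comb_g in auto)
qed

text \<open>As \<open>comb_mat h\<close> is supported where \<open>comb_mat g\<close> is at least \<open>c\<close>, the trace of the product
  of the two matrices is at least \<open>c * n * comb h k = comb g k * comb h k\<close>.\<close>

lemma sum_list_g_h_nonneg:
  assumes "\<And>i. i < d \<Longrightarrow> h i > 0" "h d = 0"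
  shows "(\<Sum>e\<leftarrow>es. comb g e * comb h e) \<ge> 0"
proof -
  have "c * comb_mat h x y \<le> comb_mat g x y * comb_mat h x y" for x y
  proof (cases "comb_mat h x y = 0")
    case False
    then obtain i where "i \<le> d" "h i * real (nb_walks i x y) \<noteq> 0"
      unfolding comb_mat_def by (meson atMost_iff sum.not_neutral_contains_not_neutral)
    then have "i < d" "nb_walks i x y \<noteq> 0" using assms(2) by (auto simp: le_less)
    \<comment> \<open>Integrality enters here: a nonzero count is at least 1.\<close>
    then have "1 \<le> (\<Sum>i<d. nb_walks i x y)"
      using member_le_sum[of i "{..<d}" "\<lambda>i. nb_walks i x y"] by simp
    then have "c * 1 \<le> c * real (\<Sum>i<d. nb_walks i x y)"
      using c1 by (intro mult_left_mono) linarith+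
    then have "c \<le> comb_mat g x y" unfolding comb_mat_g by simp
    moreover have "comb_mat h x y \<ge> 0"
      unfolding comb_mat_def split_last using assms by (auto intro!: sum_nonneg simp: less_imp_le)
    ultimately show ?thesis by (rule mult_right_mono)
  qed simp
  then have "(\<Sum>x\<in>V. \<Sum>y\<in>V. c * comb_mat h x y) \<le> (\<Sum>x\<in>V. \<Sum>y\<in>V. comb_mat g x y * comb_mat h x y)"
    by (intro sum_mono)
  moreover have "(\<Sum>x\<in>V. \<Sum>y\<in>V. c * comb_mat h x y) = comb g k * comb h k"
    unfolding sum_distrib_left[symmetric] by (simp add: sum_comb_mat comb_g_degree)
  ultimately show ?thesis unfolding trace_comb by simp
qed

lemma second_eigenvalue_ge: "\<tau> \<ge> lambda_dc r u d c"
  and second_eigenvalue_eq_imp: "\<tau> = lambda_dc r u d c \<Longrightarrow> e \<in> set es \<Longrightarrow> comb g e = 0"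
proof -
  obtain h \<gamma> where h: "\<gamma> > 0" "\<And>i. i < d \<Longrightarrow> h i > 0" "h d = 0"
    "\<And>x. (x - lambda_dc r u d c) * comb h x = \<gamma> * comb g x"
    by (rule kernel) (rule that; blast)
  \<comment> \<open>Multiplying the kernel identity by \<open>h\<close> produces a square, so the
    sign of each term is that of \<open>e\<close> minus \<lambda>.\<close>
  have "(\<Sum>e\<leftarrow>es. (e - lambda_dc r u d c) * (comb h e)\<^sup>2) = \<gamma> * (\<Sum>e\<leftarrow>es. comb g e * comb h e)"
    unfolding sum_list_const_mult[symmetric] power2_eq_square mult.assoc[symmetric] h(4) ..
  then have nonneg: "(\<Sum>e\<leftarrow>es. (e - lambda_dc r u d c) * (comb h e)\<^sup>2) \<ge> 0"
    using sum_list_g_h_nonneg[of h, OF h(2,3)] h(1) by simp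
  have zero: "(e - lambda_dc r u d c) * (comb h e)\<^sup>2 = 0" if "\<tau> \<le> lambda_dc r u d c" "e \<in> set es" for e
  proof (rule sum_list_nonpos_eq_0[OF _ nonneg that(2)])
    fix e assume "e \<in> set es"
    then have "e - lambda_dc r u d c \<le> 0" using second_max[of e] that(1) by simp
    then show "(e - lambda_dc r u d c) * (comb h e)\<^sup>2 \<le> 0" by (simp add: mult_nonpos_nonneg)
  qed
  show "\<tau> \<ge> lambda_dc r u d c"
  proof (rule ccontr)
    assume "\<not> ?thesis"
    then have less: "\<tau> < lambda_dc r u d c" by simp
    have "comb h e = 0" if "e \<in> set es" for e
      using zero[of e] that second_max[OF that] less by auto
    then have const: "comb_mat h x y = comb h k / n" if "x \<in> V" "y \<in> V" for x y
      using comb_vanishes_iff that by blast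
    have "comb h k > 0"
      unfolding comb_def split_last using h(2,3) F_pos d1
      by (auto intro!: sum_pos simp: lessThan_empty_iff)
    moreover obtain x where x: "x \<in> V" using ne by blast
    \<comment> \<open>At this pair \<open>h(A)\<close> has entry 0, as \<open>h\<close> has no
      \<open>F_d\<close> term, while the constant entry \<open>h(k)/n\<close> is positive.\<close>
    moreover obtain y where "y \<in> V" "\<And>i. i < d \<Longrightarrow> nb_walks i x y = 0"
      using ex_far_pair[OF x] by blast
    moreover from this have "comb_mat h x y = 0"
      unfolding comb_mat_def split_last by (simp add: h(3))
    ultimately show False using const[of x y] n_ge_2 by simp
  qed
  show "comb g e = 0" if "\<tau> = lambda_dc r u d c" "e \<in> set es"
  proof -
    \<comment> \<open>Either \<open>e\<close> equals \<lambda> or \<open>h(e) = 0\<close>; squaring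
      the kernel identity handles both at once.\<close>
    have "(\<gamma> * comb g e)\<^sup>2 = (e - lambda_dc r u d c) * ((e - lambda_dc r u d c) * (comb h e)\<^sup>2)"
      unfolding h(4)[symmetric] by (simp add: power2_eq_square mult_ac)
    then show ?thesis using zero[of e] that h(1) by simp
  qed
qed

text \<open>Conversely, if \<open>g\<close> vanishes on \<open>es\<close>, then \<tau> is a zero of
  \<open>g\<close>, hence at most the largest one. The constant entry of \<open>g(A)\<close> is
  \<open>g(k)/n = c\<close>.\<close>

lemma second_eigenvalue_eq_iff:
  "\<tau> = lambda_dc r u d c \<longleftrightarrow>
    (\<forall>x\<in>V. \<forall>y\<in>V. c * real (\<Sum>i<d. nb_walks i x y) + real (nb_walks d x y) = c)"
proof -
  have "\<tau> = lambda_dc r u d c \<longleftrightarrow> (\<forall>e\<in>set es. comb g e = 0)"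
    using second_eigenvalue_eq_imp second_eigenvalue_ge second_in
      lambda_dc(2)[OF r2 u2 refl d1, of c] by (metis antisym comb_g)
  then show ?thesis
    unfolding comb_vanishes_iff comb_mat_g comb_g_degree using n_ge_2 by simp
qed

end

section \<open>The equality case\<close>

context hypergraph_spectrum
begin

section \<open>The matrix equation \<open>g(A) = c J\<close> and the intersection array\<close>

definition tight :: bool where
  "tight \<longleftrightarrow> (\<forall>x\<in>V. \<forall>y\<in>V. c * real (\<Sum>i<d. nb_walks i x y) + real (nb_walks d x y) = c)"

definition path_count :: "nat \<Rightarrow> real" where
  "path_count i = (if i = d then c else 1)"

abbreviation "gdist x y \<equiv> graph_distance G x y"

text \<open>With \<open>S\<close> natural and \<open>c \<ge> 1\<close>, the equation
  \<open>c S + N = c\<close> leaves \<open>S = 0, N = c\<close> or \<open>S = 1, N = 0\<close>; so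
  exactly one length up to \<open>d\<close> carries walks from \<open>x\<close> to
  \<open>y\<close>.\<close>

lemma tight_nb_walks:
  assumes tight "x \<in> V" "y \<in> V"
  shows "\<exists>i\<le>d. \<forall>j\<le>d. real (nb_walks j x y) = (if j = i then path_count i else 0)"
proof -
  let ?S = "\<Sum>i<d. nb_walks i x y"
  have eq: "c * real ?S + real (nb_walks d x y) = c"
    using assms by (simp only: tight_def)
  show ?thesis
  proof (cases "?S = 0")
    case True
    then have "nb_walks j x y = 0" if "j < d" for j using that by simp
    moreover have "real (nb_walks d x y) = c" using eq unfolding True by simp
    ultimately show ?thesis
      by (intro exI[of _ d]) (auto simp: path_count_def le_less)
  next
    case False
    have "c * real ?S \<le> c * 1" using eq by simp
    then have "real ?S \<le> 1" using c1 by (subst (asm) mult_le_cancel_left_pos) auto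
    then have S: "?S = 1" using False by linarith
    then have d0: "nb_walks d x y = 0" using eq by simp
    obtain i where i: "i < d" "nb_walks i x y \<noteq> 0"
      using False by (meson lessThan_iff sum.not_neutral_contains_not_neutral)
    have "?S = nb_walks i x y + (\<Sum>j\<in>{..<d} - {i}. nb_walks j x y)"
      using i(1) by (intro sum.remove) auto
    then have "nb_walks i x y = 1" "(\<Sum>j\<in>{..<d} - {i}. nb_walks j x y) = 0"
      using S i(2) by linarith+
    then show ?thesis
      using i(1) d0 by (intro exI[of _ i]) (auto simp: path_count_def le_less)
  qed
qed

lemma path_count_pos: "path_count i > 0"
  using c1 by (simp add: path_count_def)

lemma distance_of_nb_walks:
  assumes "x \<in> V" "y \<in> V" "i \<le> d" "\<And>j. j \<le> d \<Longrightarrow> real (nb_walks j x y) = (if j = i then path_count i else 0)"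
  shows "gdist x y = ereal (real i)"
proof -
  have "nb_walks i x y \<noteq> 0" using assms(3) assms(4)[of i] path_count_pos[of i] by auto
  moreover have "nb_walks j x y = 0" if "j < i" for j
    using assms(3) assms(4)[of j] that by simp
  ultimately show ?thesis unfolding distance_iff_nb_walks[OF assms(1,2)] by blast
qed

lemma tight_distance:
  assumes tight "x \<in> V" "y \<in> V"
  shows "\<exists>i\<le>d. gdist x y = ereal (real i)"
  using tight_nb_walks[OF assms] distance_of_nb_walks[OF assms(2,3)] by metis

lemma tight_nb_walks_distance:
  assumes tight "x \<in> V" "y \<in> V" "gdist x y = ereal (real i)" "j \<le> d"
  shows "real (nb_walks j x y) = (if j = i then path_count i else 0)"
proof -
  obtain l where l: "l \<le> d" "\<And>j. j \<le> d \<Longrightarrow> real (nb_walks j x y) = (if j = l then path_count l else 0)"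
    using tight_nb_walks[OF assms(1-3)] by metis
  then have "gdist x y = ereal (real l)"
    by (rule distance_of_nb_walks[OF assms(2,3)])
  then show ?thesis using assms(4,5) l(2) by simp
qed

lemma real_num_edges:
  "real (num_edges_to_distance G x y j)
     = (\<Sum>z\<in>V. (if gdist x z = ereal (real j) then 1 else 0) * real (adjacency E z y))"
  unfolding num_edges_to_distance_eq of_nat_sum
  by (rule sum.cong[OF refl]) (simp add: adjacency_commute[of _ y])

lemma sum_nb_walks_adjacency:
  assumes "x \<in> V" "y \<in> V"
  shows "(\<Sum>z\<in>V. real (nb_walks j x z) * real (adjacency E z y)) = real (nb_walks (Suc j) x y)
    + (if j = 0 then 0 else (real u - 2) * real (nb_walks j x y)
        + (if j = 1 then k else q) * real (nb_walks (j - 1) x y))"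
proof (cases "j = 0")
  case True
  have "(\<Sum>z\<in>V. real (nb_walks 0 x z) * real (adjacency E z y)) = real (adjacency E x y)"
    using finV assms(1) by (simp add: if_distrib[of "\<lambda>a. a * _"] if_distrib[of real] cong: if_cong)
  then show ?thesis
    using True nb_walks_1[OF assms] by simp
next
  case False
  then show ?thesis using nb_walks_rec[OF assms(2), of j x] by simp
qed

text \<open>For \<open>j < d\<close> the matrix \<open>nb_walks j\<close> is the indicator of
  distance \<open>j\<close>, so the count is an entry of its product with \<open>A\<close>, known
  from the recurrence.\<close>

lemma tight_num_edges:
  assumes t: tight and V: "x \<in> V" "y \<in> V" and i: "gdist x y = ereal (real i)" "i \<le> d" and j: "j < d"
  shows "real (num_edges_to_distance G x y j) = (if i = Suc j then path_count i else 0)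
    + (if i = j then (if i = 0 then 0 else real u - 2) else 0)
    + (if Suc i = j then (if i = 0 then k else q) else 0)"
proof -
  have "(if gdist x z = ereal (real j) then 1 else 0) = real (nb_walks j x z)" if z: "z \<in> V" for z
  proof -
    obtain l where l: "gdist x z = ereal (real l)" using tight_distance[OF t V(1) z] by blast
    then show ?thesis
      using tight_nb_walks_distance[OF t V(1) z l, of j] j by (simp add: path_count_def)
  qed
  then have "real (num_edges_to_distance G x y j)
      = (\<Sum>z\<in>V. real (nb_walks j x z) * real (adjacency E z y))"
    unfolding real_num_edges by (intro sum.cong refl) simp
  moreover have "real (nb_walks (Suc j) x y) = (if i = Suc j then path_count i else 0)"
    "real (nb_walks j x y) = (if i = j then path_count i else 0)"
    "real (nb_walks (j - 1) x y) = (if i = j - 1 then path_count i else 0)"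
    using tight_nb_walks_distance[OF t V i(1)] j by auto
  ultimately show ?thesis
    unfolding sum_nb_walks_adjacency[OF V] using j by (auto simp: path_count_def)
qed

lemma tight_sum_num_edges:
  assumes t: tight and V: "x \<in> V" "y \<in> V"
  shows "(\<Sum>j\<le>d. real (num_edges_to_distance G x y j)) = k"
proof -
  have "(\<Sum>j\<le>d. real (num_edges_to_distance G x y j))
      = (\<Sum>z\<in>V. (\<Sum>j\<le>d. if gdist x z = ereal (real j) then 1 else 0) * real (adjacency E z y))"
    unfolding real_num_edges sum_distrib_right by (rule sum.swap)
  also have "\<dots> = (\<Sum>z\<in>V. real (adjacency E z y))"
  proof (rule sum.cong[OF refl])
    fix z assume "z \<in> V"
    then obtain l where "l \<le> d" "gdist x z = ereal (real l)" using tight_distance[OF t V(1)] by blast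
    then show "(\<Sum>j\<le>d. if gdist x z = ereal (real j) then 1 else 0) * real (adjacency E z y)
        = real (adjacency E z y)" by simp
  qed
  finally show ?thesis using degree_adjacency[OF V(2)] by simp
qed

text \<open>For distance \<open>d\<close> the recurrence would involve
  \<open>nb_walks (Suc d)\<close>, so the count is obtained as the rest of the degree
  \<open>k\<close>.\<close>

lemma tight_num_edges_last:
  assumes t: tight and V: "x \<in> V" "y \<in> V" and i: "gdist x y = ereal (real i)" "i \<le> d" "d \<le> Suc i"
  shows "real (num_edges_to_distance G x y d) = (if i = d then k - c else if i = 0 then k else q)"
proof -
  have "(\<Sum>j<d. if i = Suc j then path_count i else 0) = (if i = 0 then 0 else path_count i)"
    using i(2) by (cases i) auto
  moreover have "(\<Sum>j<d. if i = j then (if i = 0 then 0 else real u - 2) else 0)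
      = (if i = d \<or> i = 0 then 0 else real u - 2)"
    using i(2,3) by auto
  moreover have "(\<Sum>j<d. if Suc i = j then (if i = 0 then k else q) else 0) = 0"
    using i(3) by auto
  ultimately have "(\<Sum>j<d. real (num_edges_to_distance G x y j))
      = (if i = 0 then 0 else path_count i) + (if i = d \<or> i = 0 then 0 else real u - 2)"
    using tight_num_edges[OF t V i(1,2)] by (simp add: sum.distrib)
  then have "real (num_edges_to_distance G x y d)
      = k - (if i = 0 then 0 else path_count i) - (if i = d \<or> i = 0 then 0 else real u - 2)"
    using tight_sum_num_edges[OF t V] unfolding split_last by simp
  then show ?thesis
    using d1 i(2) by (auto simp: path_count_def algebra_simps)
qed

abbreviation "moore_array \<equiv> has_intersection_array G d
  (\<lambda>i. if i = d then c else 1)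
  (\<lambda>i. if i = 0 then 0 else if i = d then k - c else real u - 2)
  (\<lambda>i. if i = 0 then k else q)"

lemma tight_imp_array:
  assumes t: tight
  shows moore_array
  unfolding has_intersection_array_def verts_G
proof (intro ballI allI impI)
  fix x y i assume V: "x \<in> V" "y \<in> V" and i: "i \<le> d" "gdist x y = ereal (real i)"
  note num = tight_num_edges[OF t V i(2,1)] and last = tight_num_edges_last[OF t V i(2,1)]
  have "1 \<le> i \<longrightarrow> real (num_edges_to_distance G x y (i - 1)) = (if i = d then c else 1)"
    using i(1) num[of "i - 1"] by (auto simp: path_count_def)
  moreover have "real (num_edges_to_distance G x y i)
      = (if i = 0 then 0 else if i = d then k - c else real u - 2)"
    using i(1) num[of i] last d1 by (cases "i = d") auto
  moreover have "i < d \<longrightarrow> real (num_edges_to_distance G x y (i + 1)) = (if i = 0 then k else q)"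
    using num[of "Suc i"] last by (cases "Suc i = d") auto
  ultimately show "(1 \<le> i \<longrightarrow> real (num_edges_to_distance G x y (i - 1)) = (if i = d then c else 1)) \<and>
    real (num_edges_to_distance G x y i)
      = (if i = 0 then 0 else if i = d then k - c else real u - 2) \<and>
    (i < d \<longrightarrow> real (num_edges_to_distance G x y (i + 1)) = (if i = 0 then k else q))"
    by blast
qed

lemma tight_imp_moore_geometry:
  assumes t: tight
  shows "generalized_Moore_geometry V E r u d"
proof -
  obtain x0 where x0: "x0 \<in> V" using ne by blast
  \<comment> \<open>The equation bounds all distances by \<open>d\<close>; this vertex shows that
    \<open>d\<close> is attained.\<close>
  obtain y0 where y0: "y0 \<in> V" "\<And>i. i < d \<Longrightarrow> nb_walks i x0 y0 = 0"
    using ex_far_pair[OF x0] by blast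
  have far: "gdist x0 y0 = ereal (real d)"
  proof -
    obtain i where i: "i \<le> d" "gdist x0 y0 = ereal (real i)"
      using tight_distance[OF t x0 y0(1)] by blast
    have "\<not> i < d"
    proof
      assume "i < d"
      then show False
        using y0(2)[of i] i(2) unfolding distance_iff_nb_walks[OF x0 y0(1)] by auto
    qed
    then have "i = d" using i(1) by linarith
    then show ?thesis using i by simp
  qed
  have paths: "real (card (shortest_paths G x y)) = path_count i"
    if "x \<in> V" "y \<in> V" "gdist x y = ereal (real i)" "i \<le> d" for x y i
    using card_shortest_paths[OF that(1-3)] tight_nb_walks_distance[OF t that(1-3), of i] that(4) by simp
  have one: "card (shortest_paths G x y) = 1" if V: "x \<in> V" "y \<in> V" "gdist x y < ereal (real d)" for x y
  proof -
    obtain i where i: "i \<le> d" "gdist x y = ereal (real i)" using tight_distance[OF t V(1,2)] by blast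
    then have "i < d" using V(3) by simp
    then have "real (card (shortest_paths G x y)) = 1"
      using paths[OF V(1,2) i(2,1)] by (simp add: path_count_def)
    then show ?thesis by simp
  qed
  have "card (shortest_paths G x y) = card (shortest_paths G x0 y0)"
    if "x \<in> V" "y \<in> V" "gdist x y = ereal (real d)" for x y
    using paths[OF that] paths[OF x0 y0(1) far] by simp
  then show ?thesis
    unfolding generalized_Moore_geometry_def Let_def
    using hyp reg unif distances_imp_connected_diameter[OF tight_distance[OF t] x0 y0(1) far] one
    by blast
qed

text \<open>By induction \<open>nb_walks (i - 1)\<close> is the indicator of a distance, so its
  product with \<open>A\<close> consists of intersection numbers, and the recurrence subtracts all
  but the wanted value.\<close>

lemma array_imp_nb_walks:
  assumes array: moore_array and diam: "graph_diameter G = ereal (real d)"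
  shows "x \<in> V \<Longrightarrow> y \<in> V \<Longrightarrow> gdist x y = ereal (real j) \<Longrightarrow> j \<le> d \<Longrightarrow> i \<le> d \<Longrightarrow>
    real (nb_walks i x y) = (if i = j then path_count j else 0)"
proof (induct i arbitrary: x y j rule: less_induct)
  case (less i)
  note V = less(2,3) and j = less(4,5)
  have below: "nb_walks l x y = 0" if "l < j" for l
    using j(1) that unfolding distance_iff_nb_walks[OF V] by blast
  have array': "1 \<le> j \<Longrightarrow> real (num_edges_to_distance G x y (j - 1)) = path_count j"
    "real (num_edges_to_distance G x y j) = (if j = 0 then 0 else if j = d then k - c else real u - 2)"
    "j < d \<Longrightarrow> real (num_edges_to_distance G x y (Suc j)) = (if j = 0 then k else q)"
    using array V j unfolding has_intersection_array_def by (auto simp: path_count_def)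
  show ?case
  proof (cases i)
    case 0
    have "j = 0 \<longleftrightarrow> x = y"
      using below[of 0] j(1) unfolding distance_iff_nb_walks[OF V] by (auto split: if_splits)
    then show ?thesis using 0 d1 by (auto simp: path_count_def)
  next
    case (Suc m)
    show ?thesis
    proof (cases "i < j")
      case True
      then show ?thesis using below by simp
    next
      case False
      have m: "m < d" "m < i" using less(6) Suc by auto
      have "(if gdist x z = ereal (real m) then 1 else 0) = real (nb_walks m x z)" if z: "z \<in> V" for z
      proof -
        obtain l where l: "l \<le> d" "gdist x z = ereal (real l)"
          using diameter_imp_distance[OF diam V(1) z] by blast
        show ?thesis
          using less(1)[OF m(2) V(1) z l(2,1)] m(1) l(2) by (simp add: path_count_def)
      qed
      then have num: "real (num_edges_to_distance G x y m)
          = (\<Sum>z\<in>V. real (nb_walks m x z) * real (adjacency E z y))"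
        unfolding real_num_edges by (intro sum.cong refl) simp
      have IH: "real (nb_walks m x y) = (if m = j then path_count j else 0)"
        "real (nb_walks (m - 1) x y) = (if m - 1 = j then path_count j else 0)"
        using less(1)[of m x y j] less(1)[of "m - 1" x y j] V j m by auto
      \<comment> \<open>Such entries lie outside the array; they vanish because adjacent vertices
        have distances from \<open>x\<close> differing by at most 1.\<close>
      have far: "real (num_edges_to_distance G x y m) = 0" if "Suc j < m"
      proof -
        have "adjacency E z y = 0" if "gdist x z = ereal (real m)" for z
        proof (rule ccontr)
          assume "adjacency E z y \<noteq> 0"
          then have "m \<le> Suc j"
            using distance_step[OF j(1) that] adjacency_commute[of z y] by simp
          then show False using \<open>Suc j < m\<close> by simp
        qed
        then show ?thesis unfolding real_num_edges by (intro sum.neutral) auto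
      qed
      have step: "real (nb_walks i x y) = real (num_edges_to_distance G x y m)
        - (if m = 0 then 0 else (real u - 2) * real (nb_walks m x y)
            + (if m = 1 then k else q) * real (nb_walks (m - 1) x y))"
        using sum_nb_walks_adjacency[OF V, of m] num Suc by simp
      \<comment> \<open>The cases read off \<open>c_j\<close>, \<open>a_j\<close>,
        \<open>b_j\<close> and 0; in all but the first, the subtracted terms cancel the
        count.\<close>
      consider "j = Suc m" | "j = m" | "Suc j = m" | "Suc j < m"
        using False Suc by linarith
      then show ?thesis
      proof cases
        case 1
        then show ?thesis using step array'(1) IH Suc by simp
      next
        case 2
        then show ?thesis using step array'(2) IH Suc m by (cases m) (auto simp: path_count_def)
      next
        case 3
        then have "m \<noteq> 0" "m - 1 = j" "j < d" using m by auto
        then show ?thesis using step array'(3) IH Suc 3 by (auto simp: path_count_def)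
      next
        case 4
        then show ?thesis using step far IH Suc by auto
      qed
    qed
  qed
qed

lemma array_imp_tight:
  assumes array: moore_array and diam: "graph_diameter G = ereal (real d)"
  shows tight
  unfolding tight_def
proof (intro ballI)
  fix x y assume V: "x \<in> V" "y \<in> V"
  obtain j where j: "j \<le> d" "gdist x y = ereal (real j)"
    using diameter_imp_distance[OF diam V] by blast
  note nb = array_imp_nb_walks[OF array diam V j(2,1)]
  have "real (\<Sum>i<d. nb_walks i x y) = (\<Sum>i<d. if i = j then path_count j else 0)"
    unfolding of_nat_sum by (rule sum.cong[OF refl]) (simp add: nb)
  also have "\<dots> = (if j = d then 0 else 1)"
    using j(1) by (simp add: path_count_def)
  finally show "c * real (\<Sum>i<d. nb_walks i x y) + real (nb_walks d x y) = c"
    using nb[of d] by (cases "j = d") (simp_all add: path_count_def)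
qed

lemma second_eigenvalue_eq_iff_moore:
  "\<tau> = lambda_dc r u d c \<longleftrightarrow> generalized_Moore_geometry V E r u d \<and> moore_array"
proof -
  have "graph_diameter G = ereal (real d)" if "generalized_Moore_geometry V E r u d"
    using that by (simp add: generalized_Moore_geometry_def Let_def)
  then show ?thesis
    using second_eigenvalue_eq_iff tight_imp_array tight_imp_moore_geometry array_imp_tight
    unfolding tight_def[symmetric] by blast
qed

end

theorem theorem8p2:
  fixes V :: "'v set" and E :: "'v set set" and r u n :: nat and k q :: real
  assumes "r \<ge> 2" and "u \<ge> 2"
    and "k = real r * (real u - 1)" and "q = (real r - 1) * (real u - 1)"
    and "hypergraph V E" and "V \<noteq> {}" and "regular V E r" and "uniform E u"
    and "card V = n"
  shows "(\<exists>!p. size_parameters k q n (fst p) (snd p)) \<and>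
    (\<forall>d c. size_parameters k q n d c \<longrightarrow>
       second_eigenvalue V E \<ge> lambda_dc r u d c \<and>
       (second_eigenvalue V E = lambda_dc r u d c \<longleftrightarrow>
          generalized_Moore_geometry V E r u d \<and>
          has_intersection_array (point_multigraph V E) d
            (\<lambda>i. if i = d then c else 1)
            (\<lambda>i. if i = 0 then 0 else if i = d then k - c else real u - 2)
            (\<lambda>i. if i = 0 then k else q)))"
proof -
  interpret H: regular_uniform_hypergraph V E r u
    by unfold_locales (use assms in auto)
  have "k > 0" using assms(1-3) by simp
  then have "\<exists>!p. size_parameters k q n (fst p) (snd p)"
    using size_parameters_ex1 q_ge_1[OF assms(1,2,4)] H.n_ge_2 assms(9) by simp
  moreover have "second_eigenvalue V E \<ge> lambda_dc r u d c \<and>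
       (second_eigenvalue V E = lambda_dc r u d c \<longleftrightarrow>
          generalized_Moore_geometry V E r u d \<and>
          has_intersection_array (point_multigraph V E) d
            (\<lambda>i. if i = d then c else 1)
            (\<lambda>i. if i = 0 then 0 else if i = d then k - c else real u - 2)
            (\<lambda>i. if i = 0 then k else q))"
    if "size_parameters k q n d c" for d c
  proof (rule H.spectrum)
    fix es
    assume es: "second_eigenvalue V E \<in> set es" "\<And>e. e \<in> set es \<Longrightarrow> e \<le> second_eigenvalue V E"
      "\<And>i j. (\<Sum>x\<in>V. \<Sum>y\<in>V. real (H.nb_walks i x y) * real (H.nb_walks j x y))
        = poly (F_poly r u i) (real r * (real u - 1)) * poly (F_poly r u j) (real r * (real u - 1))
          + (\<Sum>e\<leftarrow>es. poly (F_poly r u i) e * poly (F_poly r u j) e)"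
    interpret S: hypergraph_spectrum V E r u d c es
      by unfold_locales (use that es assms(3,4,9) in auto)
    show ?thesis
      using S.second_eigenvalue_ge S.second_eigenvalue_eq_iff_moore unfolding assms(3,4) by blast
  qed
  ultimately show ?thesis by blast
qed

end
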